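(* Assume that the following conditions hold: (i) $B_\rho(x^\dag)\subset D(F)$ for some $\rho>4\|x_0-x^\dag\|$; (ii) there exists a constant $L$ such that $\|F'(x)-F'(z)\|\le L\|x-z\|$ for all $x,z\in B_\rho(x^\dag)$; (iii) $\|F'(x)\|\le \alpha_0^{1/2}$ for all $x\in B_\rho(x^\dag)$; and that the stopping index $k_\delta$ is determined by the a posteriori rule given in the context with $\tau>2$. If $x_0-x^\dag=F'(x^\dag)^*v$ for some $v\in \mathcal N(F'(x^\dag)^* )^\perp\subset Y$ and if $L\|v\|$ is sufficiently small, then $$\|x_{k_\delta}^\delta-x^\dag\|\le C\inf\left\{\|x_k-x^\dag\|+\frac{\delta}{\sqrt{\alpha_k}}:\ k=0,1,\dots\right\}.$$ In particular, if, in addition, $x_0-x^\dag=(F'(x^\dag)^*F'(x^\dag))^{\nu/2}\omega$ for some $\omega\in X$ and some $1\le\nu\le 2$, then $$\|x_{k_\delta}^\delta-x^\dag\|\le C\|\omega\|^{1/(1+\nu)}\delta^{\nu/(1+\nu)}.$$ Here $C$ is a constant independent of $\delta$.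
   Context: $X,Y$ are Hilbert spaces (norms and inner products of both denoted $\|\cdot\|$, $(\cdot,\cdot)$). $F:D(F)\subset X\to Y$ is a nonlinear Fréchet differentiable operator, with Fréchet derivative $F'(x)$ at $x\in D(F)$ and adjoint $F'(x)^*$. The equation $F(x)=y$ has a solution $x^\dag\in D(F)$, i.e. $F(x^\dag)=y$. The available data is $y^\delta\in Y$ with $\|y^\delta-y\|\le\delta$, where $\delta>0$ is a given small noise level. $B_\rho(x^\dag)$ is the ball of radius $\rho>0$ around $x^\dag$; $\mathcal N(T)$ is the null space of $T$. $x_0$ is an initial guess of $x^\dag$. $\{\alpha_k\}$ is a given sequence with $\alpha_k>0$, $1\le\alpha_k/\alpha_{k+1}\le r$ and $\lim_{k\to\infty}\alpha_k=0$, for some constant $r>1$. The iteratively regularized Gauss-Newton iterates are defined by $x_0^\delta:=x_0$ and $$x_{k+1}^\delta=x_k^\delta-\left(\alpha_kI+F'(x_k^\delta)^*F'(x_k^\delta)\right)^{-1}\left(F'(x_k^\delta)^*(F(x_k^\delta)-y^\delta)+\alpha_k(x_k^\delta-x_0)\right).$$ The sequence $\{x_k\}$ is the one defined by the same method, from the same $x_0$, in the noise-free case: $$x_{k+1}=x_k-\left(\alpha_kI+F'(x_k)^*F'(x_k)\right)^{-1}\left(F'(x_k)^*(F(x_k)-y)+\alpha_k(x_k-x_0)\right).$$ The stopping index $k_\delta$ is the first integer satisfying $$\alpha_{k_\delta}\left(F(x_{k_\delta}^\delta)-y^\delta,\ (\alpha_{k_\delta}I+F'(x_{k_\delta}^\delta)F'(x_{k_\delta}^\delta)^*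 )^{-1}(F(x_{k_\delta}^\delta)-y^\delta)\right)\le\tau^2\delta^2.$$ *)

theory Defs
  imports "HOL-Analysis.Analysis" "HOL-Computational_Algebra.Polynomial"
begin

text \<open>
  Hilbert spaces are types of sort \<open>{real_inner, banach}\<close>.  On bounded operators between
  them \<^const>\<open>adjoint\<close> is the usual Hilbert space adjoint (Riesz representation).
\<close>

definition poly_op :: "real poly \<Rightarrow> ('a::real_vector \<Rightarrow> 'a) \<Rightarrow> 'a \<Rightarrow> 'a" where
  "poly_op p A x = (\<Sum>i\<le>degree p. coeff p i *\<^sub>R (A ^^ i) x)"

text \<open>
  Continuous functional calculus for a bounded nonnegative self-adjoint operator \<open>A\<close> on a
  Hilbert space.  The spectrum of \<open>A\<close> lies in \<open>[0, \<parallel>A\<parallel>]\<close>, and \<open>p \<mapsto> p(A)\<close> satisfies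
  \<open>\<parallel>p(A)\<parallel> \<le> sup {\<bar>p t\<bar> : 0 \<le> t \<le> \<parallel>A\<parallel>}\<close> on polynomials.  For \<open>f\<close> continuous on this interval,
  \<open>f(A)\<close> is the value of the unique continuous extension of that map, i.e. the one operator
  with \<open>\<parallel>p(A) - f(A)\<parallel> \<le> \<epsilon>\<close> whenever \<open>\<bar>p - f\<bar> \<le> \<epsilon>\<close> on the interval.
\<close>

definition fun_calc :: "(real \<Rightarrow> real) \<Rightarrow> ('a::real_inner \<Rightarrow> 'a) \<Rightarrow> 'a \<Rightarrow> 'a" where
  "fun_calc f A = (THE B. \<forall>p \<epsilon>. (\<forall>t\<in>{0..onorm A}. \<bar>poly p t - f t\<bar> \<le> \<epsilon>) \<longrightarrow>
                               (\<forall>x. norm (poly_op p A x - B x) \<le> \<epsilon> * norm x))"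

text \<open>
  Meant for exponents \<open>s > 0\<close>, where \<open>t powr s\<close> (with \<open>0 powr s = 0\<close>) is continuous
  on \<open>[0, \<infinity>)\<close>.
\<close>

definition op_powr :: "('a::real_inner \<Rightarrow> 'a) \<Rightarrow> real \<Rightarrow> 'a \<Rightarrow> 'a" where
  "op_powr A s = fun_calc (\<lambda>t. t powr s) A"

text \<open>
  \<open>reg_inv a A = (a I + A)\<inverse>\<close>; for \<open>a > 0\<close> and bounded nonnegative self-adjoint \<open>A\<close> the map
  \<open>a I + A\<close> is a bijection of the space.
\<close>

definition reg_inv :: "real \<Rightarrow> ('a::real_vector \<Rightarrow> 'a) \<Rightarrow> 'a \<Rightarrow> 'a" where
  "reg_inv a A = inv (\<lambda>z. a *\<^sub>R z + A z)"

text \<open>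
  Iteratively regularized Gauss-Newton iterates for the right-hand side \<open>g\<close> (noisy or exact)
  with initial guess \<open>x0\<close>.
\<close>

primrec irgn :: "('a::real_inner \<Rightarrow> 'b::real_inner) \<Rightarrow> ('a \<Rightarrow> 'a \<Rightarrow>\<^sub>L 'b) \<Rightarrow> (nat \<Rightarrow> real) \<Rightarrow> 'a \<Rightarrow> 'b
    \<Rightarrow> nat \<Rightarrow> 'a" where
  "irgn F F' \<alpha> x0 g 0 = x0"
| "irgn F F' \<alpha> x0 g (Suc k) =
    (let x = irgn F F' \<alpha> x0 g k; T = blinfun_apply (F' x); Ts = adjoint T in
       x - reg_inv (\<alpha> k) (Ts \<circ> T) (Ts (F x - g) + \<alpha> k *\<^sub>R (x - x0)))"

definition stop_rule :: "('a::real_inner \<Rightarrow> 'b::real_inner) \<Rightarrow> ('a \<Rightarrow> 'a \<Rightarrow>\<^sub>L 'b) \<Rightarrow> (nat \<Rightarrow> real) \<Rightarrow> 'a \<Rightarrow> 'b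
    \<Rightarrow> real \<Rightarrow> real \<Rightarrow> nat \<Rightarrow> bool" where
  "stop_rule F F' \<alpha> x0 g \<tau> \<delta> k \<longleftrightarrow>
    (let x = irgn F F' \<alpha> x0 g k; T = blinfun_apply (F' x); res = F x - g in
       \<alpha> k * (res \<bullet> reg_inv (\<alpha> k) (T \<circ> adjoint T) res) \<le> \<tau>\<^sup>2 * \<delta>\<^sup>2)"

definition stop_index :: "('a::real_inner \<Rightarrow> 'b::real_inner) \<Rightarrow> ('a \<Rightarrow> 'a \<Rightarrow>\<^sub>L 'b) \<Rightarrow> (nat \<Rightarrow> real) \<Rightarrow> 'a \<Rightarrow> 'b
    \<Rightarrow> real \<Rightarrow> real \<Rightarrow> nat" where
  "stop_index F F' \<alpha> x0 g \<tau> \<delta> = (LEAST k. stop_rule F F' \<alpha> x0 g \<tau> \<delta> k)"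

end

theory Submission
  imports Defs
begin

text \<open>
  Write \<open>e\<^sub>k\<close> for the error of the \<open>k\<close>-th iterate, \<open>T\<close> for the derivative at the solution and
  \<open>T\<^sub>k\<close> for the derivative at the iterate, \<open>A = T\<^sup>*T\<close>, \<open>A\<^sub>k = T\<^sub>k\<^sup>*T\<^sub>k\<close>, \<open>g\<close> for the data.  One step of the method gives
  \<open>e\<^sub>k\<^sub>+\<^sub>1 = \<alpha>\<^sub>k(\<alpha>\<^sub>k + A\<^sub>k)\<^sup>-\<^sup>1 e\<^sub>0 - (\<alpha>\<^sub>k + A\<^sub>k)\<^sup>-\<^sup>1 T\<^sub>k\<^sup>*(F x\<^sub>k - g - T\<^sub>k e\<^sub>k)\<close>.
  The second term is at most \<open>\<delta>/(2\<surd>\<alpha>\<^sub>k)\<close> plus a Taylor remainder.  By the source condition the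
  first term differs from \<open>lin\<^sub>k = \<alpha>\<^sub>k(\<alpha>\<^sub>k + A)\<^sup>-\<^sup>1 e\<^sub>0\<close>, which is the error of
  Tikhonov regularisation with exact data for the linearised problem (\<open>lin_error\<close>),
  only by a small multiple of \<open>\<parallel>e\<^sub>k\<parallel>\<close> (lemma \<open>scaled_resolvent_perturbation\<close>).  All errors
  are therefore compared with \<open>\<parallel>lin\<^sub>k\<parallel>\<close>, which decreases in \<open>k\<close> and loses at most a factor \<open>2r\<close>
  in each step.

  Up to stopping, the weighted residual exceeds \<open>\<tau>\<delta>\<close>, whereas the noise contributes at most \<open>\<delta>\<close> to
  it.  Since \<open>\<tau> > 2\<close>, this forces \<open>\<delta>\<close> below a multiple of \<open>\<surd>\<alpha>\<^sub>k \<parallel>lin\<^sub>k\<parallel>\<close>, and the induction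
  \<open>\<parallel>e\<^sub>k\<parallel> \<le> K\<parallel>lin\<^sub>k\<parallel>\<close> closes (\<open>before_stop\<close>).  Without noise the reverse inequality
  \<open>\<parallel>lin\<^sub>k\<parallel> \<le> 2\<parallel>e\<^sub>k\<parallel>\<close> holds as well (\<open>noise_free_lower\<close>).  For \<open>k\<close> up to the stopping index \<open>l\<close>
  monotonicity gives \<open>\<parallel>e\<^sub>l\<parallel> \<le> K\<parallel>lin\<^sub>l\<parallel> \<le> K\<parallel>lin\<^sub>k\<parallel>\<close> at once.

  For \<open>k \<ge> l\<close> the stopping rule must be used in the other direction.  Let \<open>x\<close> be the stopped iterate,
  \<open>e = e\<^sub>l\<close> its error, \<open>T\<^sub>x\<close> the derivative at \<open>x\<close> and \<open>A\<^sub>x = T\<^sub>x\<^sup>*T\<^sub>x\<close>.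
  Its optimality condition can be rewritten with the derivative at \<open>x\<close> itself: for every
  \<open>\<beta> \<le> \<alpha>\<^sub>l\<close> the vector \<open>\<beta>(x\<^sub>0 - x)\<close> is \<open>\<theta> T\<^sub>x\<^sup>*(F x - g)\<close> with \<open>0 \<le> \<theta> \<le> 1\<close>, up to a harmless
  term (\<open>residual_representable\<close>).  Hence \<open>e\<close> is \<open>\<beta>(\<beta> + A\<^sub>x)\<^sup>-\<^sup>1 e\<^sub>0\<close> plus
  \<open>(1 - \<theta>)(\<beta> + A\<^sub>x)\<^sup>-\<^sup>1 T\<^sub>x\<^sup>*(F x - g)\<close> plus remainders.  The weight in the stopping rule is such that
  the last displayed term is at most \<open>3\<tau>\<delta>/(2\<surd>\<beta>)\<close> for every such \<open>\<beta>\<close>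
  (\<open>norm_R_S_le_res_norm\<close>).  Choosing \<open>\<beta> = \<alpha>\<^sub>k\<close> compares \<open>e\<close> with \<open>lin\<^sub>k\<close>.  The Taylor
  remainder \<open>L\<parallel>e\<parallel>\<^sup>2/\<surd>\<beta>\<close> is not small against \<open>\<parallel>e\<parallel>\<close> when \<open>\<beta>\<close> is much smaller than \<open>\<alpha>\<^sub>l\<close>; it is
  bounded by \<open>(\<tau> + 1)\<delta>/\<surd>\<beta>\<close>, because pairing the same identity, at \<open>\<beta> = \<alpha>\<^sub>l\<close>, with \<open>e\<close> and
  shifting \<open>T\<^sub>x\<^sup>*\<close> off the source element \<open>v\<close> yields \<open>L\<parallel>e\<parallel>\<^sup>2 \<le> (\<tau> + 1)\<delta>\<close> (\<open>L_stopped_error_sq\<close>).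

  The convergence rates follow from \<open>\<parallel>lin\<^sub>k\<parallel> \<le> \<alpha>\<^sub>k\<^bsup>\<nu>/2\<^esup>\<parallel>\<omega>\<parallel>\<close> by balancing this bound against
  \<open>\<delta>/\<surd>\<alpha>\<^sub>k\<close>.  The bound is a functional calculus estimate.  It rests on the fact that a polynomial
  which is nonnegative on \<open>[0, M]\<close> is, up to a vanishing constant, a nonnegative combination of
  Bernstein polynomials, whose values at an operator between \<open>0\<close> and \<open>M\<close> are nonnegative.
\<close>

section \<open>Adjoints and regularised inverses\<close>

text \<open>
  The representing vector minimises the quadratic functional \<open>b x x - 2 \<phi> x\<close>; minimising
  sequences are Cauchy by the parallelogram law.  The inner product gives the Riesz representation
  theorem, hence adjoints, and the form \<open>a (x \<bullet> y) + T x \<bullet> T y\<close> gives the solvability of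
  \<open>(a + T\<^sup>*T) w = z\<close>.
\<close>

lemma coercive_symmetric_form_represents:
  fixes b :: "'a::banach \<Rightarrow> 'a \<Rightarrow> real" and \<phi> :: "'a \<Rightarrow> real"
  assumes b: "bounded_bilinear b" and sym: "\<And>x y. b x y = b y x"
    and c: "c > 0" "\<And>x. c * (norm x)\<^sup>2 \<le> b x x" and \<phi>: "bounded_linear \<phi>"
  shows "\<exists>w. \<forall>x. b w x = \<phi> x"
proof -
  interpret b: bounded_bilinear b by fact
  interpret \<phi>: bounded_linear \<phi> by fact
  define J where "J x = b x x - 2 * \<phi> x" for x
  have bnn: "0 \<le> b x x" for x
    using c(2)[of x] c(1) by (meson mult_nonneg_nonneg order_trans less_imp_le zero_le_power2)
  obtain M where M: "\<And>x. \<bar>\<phi> x\<bar> \<le> norm x * M"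
    using \<phi>.bounded by (auto simp: real_norm_def)
  have lower: "- (M\<^sup>2 / c) \<le> J x" for x
  proof -
    have "0 \<le> (c * norm x - M)\<^sup>2 / c" using c(1) by simp
    also have "\<dots> = c * (norm x)\<^sup>2 - 2 * (norm x * M) + M\<^sup>2 / c"
      using c(1) by (simp add: power2_diff field_simps power2_eq_square)
    also have "\<dots> \<le> J x + M\<^sup>2 / c"
      using c(2)[of x] M[of x] unfolding J_def by linarith
    finally show ?thesis by simp
  qed
  then have bdd: "bdd_below (range J)" by (auto intro!: bdd_belowI)
  define m where "m = (INF x. J x)"
  have m: "m \<le> J x" for x
    unfolding m_def by (rule cINF_lower[OF bdd]) simp
  have "\<exists>x. J x < m + 1 / real (Suc n)" for n
    using cInf_lessD[of "range J" "m + 1 / real (Suc n)"] by (auto simp: m_def)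
  then obtain X where X: "\<And>n. J (X n) < m + 1 / real (Suc n)" by metis
  have parallelogram: "J x + J y = 2 * J ((1/2) *\<^sub>R (x + y)) + b (x - y) (x - y) / 2" for x y
    unfolding J_def by (simp add: b.add_left b.add_right b.diff_left b.diff_right b.scaleR_left
        b.scaleR_right \<phi>.scaleR \<phi>.add sym[of y x] field_simps)
  have close: "c * (norm (X i - X j))\<^sup>2 \<le> 2 / real (Suc i) + 2 / real (Suc j)" for i j
  proof -
    have "2 * m \<le> 2 * J ((1/2) *\<^sub>R (X i + X j))" using m by simp
    then have "b (X i - X j) (X i - X j) \<le> 2 * (1 / real (Suc i)) + 2 * (1 / real (Suc j))"
      using parallelogram[of "X i" "X j"] X[of i] X[of j] by linarith
    then show ?thesis using c(2)[of "X i - X j"] by simp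
  qed
  have "Cauchy X"
  proof (rule metric_CauchyI)
    fix e :: real assume e: "e > 0"
    obtain N :: nat where N: "4 / (c * e\<^sup>2) < real N" using reals_Archimedean2 by blast
    show "\<exists>M. \<forall>m\<ge>M. \<forall>n\<ge>M. dist (X m) (X n) < e"
    proof (intro exI allI impI)
      fix i j assume ij: "N \<le> i" "N \<le> j"
      have N0: "0 < real N" using N c(1) e
        by (meson divide_pos_pos mult_pos_pos order_less_trans zero_less_numeral zero_less_power)
      have "2 / real (Suc i) \<le> 2 / real N" "2 / real (Suc j) \<le> 2 / real N"
        using ij N0 by (auto intro!: divide_left_mono mult_pos_pos)
      then have "c * (norm (X i - X j))\<^sup>2 \<le> 4 / real N" using close[of i j] by simp
      also have "\<dots> < c * e\<^sup>2" using N N0 c(1) e by (simp add: field_simps)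
      finally have "(norm (X i - X j))\<^sup>2 < e\<^sup>2" using c(1) by simp
      then show "dist (X i) (X j) < e" using e
        by (simp add: dist_norm power2_less_imp_less)
    qed
  qed
  then obtain w where w: "X \<longlonglongrightarrow> w" using convergent_eq_Cauchy by blast
  have "(\<lambda>n. J (X n)) \<longlonglongrightarrow> J w"
    unfolding J_def by (intro tendsto_intros b.tendsto \<phi>.tendsto w)
  moreover have "(\<lambda>n. m + 1 / real (Suc n)) \<longlonglongrightarrow> m + 0"
    by (intro tendsto_intros LIMSEQ_Suc[OF lim_1_over_n])
  ultimately have "J w \<le> m + 0"
    by (rule LIMSEQ_le) (use X in \<open>auto intro: less_imp_le simp del: of_nat_Suc\<close>)
  then have Jw: "J w \<le> m" by simp
  show ?thesis
  proof (intro exI allI)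
    fix h
    define d where "d = b w h - \<phi> h"
    define B where "B = b h h"
    \<comment> \<open>A step along \<open>h\<close> that would lower the functional if its slope \<open>d\<close> were not zero.\<close>
    define t where "t = - d / (B + 1)"
    have B: "B \<ge> 0" by (simp add: B_def bnn)
    have "J (w + t *\<^sub>R h) = J w + (2 * t * d + t\<^sup>2 * B)"
      unfolding J_def d_def B_def
      by (simp add: b.add_left b.add_right b.scaleR_left b.scaleR_right \<phi>.add \<phi>.scaleR sym[of h w]
          algebra_simps power2_eq_square)
    then have ge: "0 \<le> 2 * t * d + t\<^sup>2 * B" using m[of "w + t *\<^sub>R h"] Jw by simp
    have "2 * t * d + t\<^sup>2 * B = - (d\<^sup>2 * (B + 2)) / (B + 1)\<^sup>2"
      using B unfolding t_def by (simp add: divide_simps power2_eq_square) (simp add: algebra_simps)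
    with ge B have "d\<^sup>2 * (B + 2) \<le> 0"
      by (simp add: divide_le_0_iff zero_le_divide_iff)
    then have "d = 0" using B by (simp add: mult_le_0_iff)
    then show "b w h = \<phi> h" by (simp add: d_def)
  qed
qed

lemma le_if_mult_self_le:
  fixes p c :: real
  assumes "p * p \<le> c * p" "0 \<le> p" "0 \<le> c" shows "p \<le> c"
  using assms by (cases "p = 0") (simp_all add: mult_le_cancel_right)

lemma two_sqrt_AM_GM:
  fixes p q :: real assumes "a > 0" shows "2 * sqrt a * (p * q) \<le> a * p\<^sup>2 + q\<^sup>2"
  using sum_squares_bound[of "sqrt a * p" q] assms
  by (simp add: power_mult_distrib mult_ac)

text \<open>
  The setting is symmetric in \<open>T\<close> and \<open>S\<close>, so that each statement about \<open>(a + ST)\<^sup>-\<^sup>1\<close> also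
  provides its counterpart for \<open>(a + TS)\<^sup>-\<^sup>1\<close>, which occurs in the stopping rule.
\<close>

locale adjoint_pair =
  fixes T :: "'a::{real_inner,banach} \<Rightarrow> 'b::{real_inner,banach}" and S :: "'b \<Rightarrow> 'a"
  assumes T: "bounded_linear T" and S: "bounded_linear S"
    and adj: "\<And>x y. T x \<bullet> y = x \<bullet> S y"
begin

interpretation T: bounded_linear T by (fact T)
interpretation S: bounded_linear S by (fact S)

lemma swap: "adjoint_pair S T"
  by standard (auto intro: T S simp: adj inner_commute[of "S _"] inner_commute[of _ "T _"])

lemma adj': "S y \<bullet> x = y \<bullet> T x"
  by (metis adj inner_commute)

lemma resolvent_unique:
  assumes "a > 0" and eq: "a *\<^sub>R w + S (T w) = a *\<^sub>R w' + S (T w')"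
  shows "w = w'"
proof -
  define d where "d = w - w'"
  have "a *\<^sub>R d + S (T d) = 0" using eq by (simp add: d_def T.diff S.diff algebra_simps)
  then have "d \<bullet> (a *\<^sub>R d + S (T d)) = 0" by simp
  then have "a * (norm d)\<^sup>2 + (norm (T d))\<^sup>2 = 0"
    by (simp add: inner_right_distrib adj[symmetric] power2_norm_eq_inner)
  then have "(norm d)\<^sup>2 = 0" using assms(1)
    by (smt (verit) mult_pos_pos zero_le_power2 zero_less_power2 zero_eq_power2)
  then show ?thesis by (simp add: d_def)
qed

lemma resolvent_exists:
  assumes "a > 0"
  shows "\<exists>w. a *\<^sub>R w + S (T w) = z"
proof -
  have "bounded_bilinear (\<lambda>x y. a * (x \<bullet> y) + T x \<bullet> T y)"
  proof (standard, goal_cases)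
    case 5
    obtain K where K: "\<And>x. norm (T x) \<le> norm x * K" "K \<ge> 0" using T.nonneg_bounded by blast
    show ?case
    proof (intro exI allI)
      fix x y
      have "\<bar>T x \<bullet> T y\<bar> \<le> (norm x * K) * (norm y * K)"
        using Cauchy_Schwarz_ineq2[of "T x" "T y"] mult_mono[OF K(1) K(1), of x y] K(2) by auto
      moreover have "\<bar>a * (x \<bullet> y)\<bar> \<le> a * (norm x * norm y)"
        using Cauchy_Schwarz_ineq2[of x y] assms by (simp add: abs_mult)
      ultimately show "norm (a * (x \<bullet> y) + T x \<bullet> T y) \<le> norm x * norm y * (a + K * K)"
        by (auto simp: algebra_simps)
    qed
  qed (simp_all add: T.add T.scaleR inner_left_distrib inner_right_distrib algebra_simps)
  moreover have "a * (norm x)\<^sup>2 \<le> a * (x \<bullet> x) + T x \<bullet> T x" for x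
    by (simp add: power2_norm_eq_inner)
  ultimately obtain w where w: "\<forall>x. a * (w \<bullet> x) + T w \<bullet> T x = z \<bullet> x"
    using coercive_symmetric_form_represents[of "\<lambda>x y. a * (x \<bullet> y) + T x \<bullet> T y" a "\<lambda>x. z \<bullet> x"]
      assms bounded_linear_inner_right by (auto simp: inner_commute)
  have "(a *\<^sub>R w + S (T w)) \<bullet> x = z \<bullet> x" for x
    using w by (simp add: inner_left_distrib adj')
  then have "a *\<^sub>R w + S (T w) = z" by (metis vector_eq_rdot)
  then show ?thesis ..
qed

definition R :: "real \<Rightarrow> 'a \<Rightarrow> 'a" where "R a = reg_inv a (S \<circ> T)"

lemma R_eqn:
  assumes "a > 0" shows "a *\<^sub>R R a z + S (T (R a z)) = z"
  using f_inv_into_f[of z "\<lambda>w. a *\<^sub>R w + S (T w)" UNIV] resolvent_exists[OF assms, of z]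
  by (auto simp: R_def reg_inv_def image_iff)

lemma R_eqI:
  assumes "a > 0" "a *\<^sub>R w + S (T w) = z" shows "R a z = w"
  by (rule resolvent_unique[OF assms(1)]) (simp add: assms R_eqn)

lemma R_add: "a > 0 \<Longrightarrow> R a (z + z') = R a z + R a z'"
  by (rule R_eqI) (use R_eqn[of a z] R_eqn[of a z'] in
      \<open>simp_all add: T.add S.add algebra_simps\<close>)

lemma R_diff: "a > 0 \<Longrightarrow> R a (z - z') = R a z - R a z'"
  by (metis R_add add_diff_cancel diff_add_cancel)

lemma R_scaleR: "a > 0 \<Longrightarrow> R a (c *\<^sub>R z) = c *\<^sub>R R a z"
  by (rule R_eqI) (use R_eqn[of a z] in
      \<open>simp_all add: T.scaleR S.scaleR flip: scaleR_add_right scaleR_scaleR\<close>, 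
       metis scaleR_add_right scaleR_left_commute)

text \<open>
  All norm bounds on the regularised inverse come from this identity, obtained by testing
  \<open>(a + ST) w = z\<close> with \<open>w\<close>.
\<close>

lemma energy:
  assumes "a > 0" shows "a * (norm (R a z))\<^sup>2 + (norm (T (R a z)))\<^sup>2 = z \<bullet> R a z"
  using arg_cong[OF R_eqn[OF assms, of z], of "\<lambda>u. u \<bullet> R a z"]
  by (simp add: inner_left_distrib adj' power2_norm_eq_inner)

lemma norm_R:
  assumes "a > 0" shows "a * norm (R a z) \<le> norm z"
proof -
  have "a * (norm (R a z))\<^sup>2 \<le> norm z * norm (R a z)"
    using energy[OF assms, of z] norm_cauchy_schwarz[of z "R a z"]
    by (smt (verit) zero_le_power2)
  then have "(a * norm (R a z)) * norm (R a z) \<le> norm z * norm (R a z)"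
    by (simp add: power2_eq_square mult_ac)
  then show ?thesis
    by (cases "R a z = 0") (auto simp: mult_right_le_imp_le)
qed

lemma norm_T_R:
  assumes "a > 0" shows "2 * sqrt a * norm (T (R a z)) \<le> norm z"
proof -
  have "(2 * sqrt a * norm (T (R a z))) * norm (R a z) \<le> norm z * norm (R a z)"
    using energy[OF assms, of z] norm_cauchy_schwarz[of z "R a z"]
      two_sqrt_AM_GM[OF assms, of "norm (R a z)" "norm (T (R a z))"] by (simp add: mult_ac)
  then show ?thesis
    by (cases "R a z = 0") (auto simp: T.zero)
qed

lemma energy_S:
  assumes "a > 0" shows "a * (norm (R a (S y)))\<^sup>2 + (norm (T (R a (S y))))\<^sup>2 = y \<bullet> T (R a (S y))"
  using energy[OF assms, of "S y"] by (simp add: adj')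

lemma norm_T_R_S:
  assumes "a > 0" shows "norm (T (R a (S y))) \<le> norm y"
proof -
  have "norm (T (R a (S y))) * norm (T (R a (S y))) \<le> norm y * norm (T (R a (S y)))"
  proof -
    have "0 \<le> a * (norm (R a (S y)))\<^sup>2" using assms by simp
    then show ?thesis
      using energy_S[OF assms, of y] norm_cauchy_schwarz[of y "T (R a (S y))"]
      by (simp add: power2_eq_square[of "norm (T _)"])
  qed
  then show ?thesis
    by (cases "T (R a (S y)) = 0") (auto simp: mult_right_le_imp_le)
qed

text \<open>
  The constant \<open>2\<close> matters: it makes the noise term \<open>\<delta>/(2\<surd>\<alpha>\<^sub>k)\<close>, so that the factor in
  \<open>\<parallel>e\<^sub>k\<^sub>+\<^sub>1\<parallel> \<le> \<parallel>e\<^sub>0\<parallel> + 3/4 \<parallel>e\<^sub>k\<parallel>\<close> is below one and the iterates stay within \<open>4\<parallel>e\<^sub>0\<parallel>\<close>.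
\<close>

lemma norm_R_S:
  assumes "a > 0" shows "2 * sqrt a * norm (R a (S y)) \<le> norm y"
proof (cases "T (R a (S y)) = 0")
  case True
  then have "a * (norm (R a (S y)))\<^sup>2 = 0" using energy_S[OF assms, of y] by simp
  then show ?thesis using assms by simp
next
  case False
  have "(2 * sqrt a * norm (R a (S y))) * norm (T (R a (S y))) \<le> norm y * norm (T (R a (S y)))"
    using energy_S[OF assms, of y] norm_cauchy_schwarz[of y "T (R a (S y))"]
      two_sqrt_AM_GM[OF assms, of "norm (R a (S y))" "norm (T (R a (S y)))"] by (simp add: mult_ac)
  then show ?thesis using False by simp
qed

text \<open>
  The operator \<open>I - T(a + ST)\<^sup>-\<^sup>1 S = a(a + TS)\<^sup>-\<^sup>1\<close> is a contraction.  Hence the noise enters the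
  linearised residual of the next iterate with norm at most \<open>\<delta>\<close>, so that a residual above \<open>2\<delta>\<close>
  has a part of size \<open>\<delta>\<close> that does not come from the noise.
\<close>

lemma norm_diff_T_R_S:
  assumes "a > 0" shows "norm (y - T (R a (S y))) \<le> norm y"
proof -
  let ?t = "T (R a (S y))"
  have "(norm (y - ?t))\<^sup>2 = (norm y)\<^sup>2 - 2 * (y \<bullet> ?t) + (norm ?t)\<^sup>2"
    by (simp add: power2_norm_eq_inner inner_diff_left inner_diff_right inner_commute)
  also have "\<dots> \<le> (norm y)\<^sup>2"
  proof -
    have "0 \<le> a * (norm (R a (S y)))\<^sup>2" using assms by simp
    then show ?thesis using energy_S[OF assms, of y] zero_le_power2[of "norm ?t"] by linarith
  qed
  finally show ?thesis by (simp add: power2_le_iff_abs_le)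
qed

lemma inner_R: "a > 0 \<Longrightarrow> x \<bullet> R a z = R a x \<bullet> z"
  using arg_cong[OF R_eqn[of a x], of "\<lambda>u. u \<bullet> R a z"]
   arg_cong[OF R_eqn[of a z], of "\<lambda>u. R a x \<bullet> u"]
  by (simp add: inner_left_distrib inner_right_distrib adj' adj[symmetric])

end

lemma adjoint_pair_adjoint:
  fixes f :: "'a::{real_inner,banach} \<Rightarrow> 'b::{real_inner,banach}"
  assumes f: "bounded_linear f"
  shows "adjoint_pair f (adjoint f)"
proof -
  interpret f: bounded_linear f by fact
  have "\<exists>z. \<forall>x. f x \<bullet> y = x \<bullet> z" for y
  proof -
    have "bounded_linear (\<lambda>x. f x \<bullet> y)"
      using bounded_linear_compose[OF bounded_linear_inner_left f] .
    then have "\<exists>z. \<forall>x. z \<bullet> x = f x \<bullet> y"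
      by (intro coercive_symmetric_form_represents[of inner 1])
         (auto simp: bounded_bilinear_inner inner_commute power2_norm_eq_inner)
    then show ?thesis by (metis inner_commute)
  qed
  then obtain g where g: "\<And>x y. f x \<bullet> y = x \<bullet> g y" by metis
  have "bounded_linear g"
  proof -
    obtain K where K: "\<And>x. norm (f x) \<le> norm x * K" "K \<ge> 0" using f.nonneg_bounded by blast
    show ?thesis
    proof (rule bounded_linear_intro)
      show "g (y + z) = g y + g z" for y z
        by (rule vector_eq_ldot[THEN iffD1]) (simp add: inner_right_distrib flip: g)
      show "g (c *\<^sub>R y) = c *\<^sub>R g y" for c y
        by (rule vector_eq_ldot[THEN iffD1]) (simp flip: g)
      show "norm (g y) \<le> norm y * K" for y
      proof -
        have "norm (g y) * norm (g y) = f (g y) \<bullet> y"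
          by (metis g power2_eq_square power2_norm_eq_inner)
        also have "\<dots> \<le> norm (g y) * K * norm y"
          using norm_cauchy_schwarz[of "f (g y)" y] mult_right_mono[OF K(1)[of "g y"] norm_ge_zero[of y]]
          by linarith
        finally have "norm (g y) * norm (g y) \<le> (norm y * K) * norm (g y)" by (simp add: mult_ac)
        then show ?thesis by (rule le_if_mult_self_le) (use K(2) in auto)
      qed
    qed
  qed
  moreover have "adjoint f = g" using g by (rule adjoint_unique[OF allI[OF allI]])
  ultimately show ?thesis using g f by (simp add: adjoint_pair_def)
qed

lemma adjoint_pair_diff:
  assumes "adjoint_pair T S" "adjoint_pair T' S'"
  shows "adjoint_pair (\<lambda>x. T x - T' x) (\<lambda>y. S y - S' y)"
  using assms by (auto simp: adjoint_pair_def inner_diff_left inner_diff_right bounded_linear_sub)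

context adjoint_pair
begin

interpretation T: bounded_linear T by (fact T)
interpretation S: bounded_linear S by (fact S)
interpretation dual: adjoint_pair S T by (rule swap)

lemma S_diff: "S (y - z) = S y - S z"
  by (rule S.diff)

lemma T_R:
  assumes "a > 0" shows "T (R a x) = dual.R a (T x)"
proof -
  have "dual.R a (T x) = T (R a x)"
    using arg_cong[OF R_eqn[OF assms, of x], of T]
    by (intro dual.R_eqI assms) (simp add: T.add T.scaleR)
  then show ?thesis by simp
qed

lemma norm_S_le:
  assumes "\<And>x. norm (T x) \<le> c * norm x" and "c \<ge> 0"
  shows "norm (S y) \<le> c * norm y"
proof -
  have "norm (S y) * norm (S y) = T (S y) \<bullet> y"
    by (metis adj power2_eq_square power2_norm_eq_inner)
  also have "\<dots> \<le> c * norm (S y) * norm y"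
    using norm_cauchy_schwarz[of "T (S y)" y]
      mult_right_mono[OF assms(1)[of "S y"] norm_ge_zero[of y]] by linarith
  finally have "norm (S y) * norm (S y) \<le> (c * norm y) * norm (S y)" by (simp add: mult_ac)
  then show ?thesis by (rule le_if_mult_self_le) (use assms(2) in auto)
qed

lemma resolvent_identity:
  assumes "a > 0" "b > 0"
  shows "R b z = R a z + (a - b) *\<^sub>R R b (R a z)"
proof -
  have "b *\<^sub>R R a z + S (T (R a z)) = z - (a - b) *\<^sub>R R a z"
    using R_eqn[OF assms(1), of z] by (simp add: algebra_simps)
  then have "R b (z - (a - b) *\<^sub>R R a z) = R a z"
    by (rule R_eqI[OF assms(2)])
  then show ?thesis
    unfolding R_diff[OF assms(2)] R_scaleR[OF assms(2)] by (simp add: diff_eq_eq)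
qed

text \<open>
  The spectral reason is that \<open>a/(a + t)\<close> increases with \<open>a\<close>; the proof uses the resolvent identity.
\<close>

lemma scaled_R_mono:
  assumes "0 < b" "b \<le> a"
  shows "norm (b *\<^sub>R R b z) \<le> norm (a *\<^sub>R R a z)"
proof -
  have "norm (b *\<^sub>R R b z) \<le> b * norm (R a z) + (a - b) * (b * norm (R b (R a z)))"
    using norm_triangle_ineq[of "b *\<^sub>R R a z" "(b * (a - b)) *\<^sub>R R b (R a z)"] assms
    by (subst resolvent_identity[of a b]) (auto simp: scaleR_add_right mult_ac)
  also have "\<dots> \<le> b * norm (R a z) + (a - b) * norm (R a z)"
    using assms by (intro add_left_mono mult_left_mono norm_R) auto
  finally show ?thesis using assms by (simp add: algebra_simps)
qed

text \<open>
  The reverse estimate, again from the resolvent identity, with a factor \<open>2\<close> from the triangle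
  inequality.
\<close>

lemma scaled_R_doubling:
  assumes "0 < b" "b \<le> a"
  shows "norm (a *\<^sub>R R a z) \<le> 2 * (a / b) * norm (b *\<^sub>R R b z)"
proof -
  have a: "0 < a" using assms by simp
  have "norm (a *\<^sub>R R a z) \<le> a * norm (R b z) + (a - b) * (a * norm (R a (R b z)))"
    using norm_triangle_ineq4[of "a *\<^sub>R R b z" "(a * (a - b)) *\<^sub>R R a (R b z)"] assms
      arg_cong[OF resolvent_identity[OF assms(1) a, of z], of "\<lambda>u. a *\<^sub>R u"]
    by (simp add: scaleR_add_right mult_ac scaleR_diff_left abs_mult) (simp add: algebra_simps)
  also have "\<dots> \<le> a * norm (R b z) + a * norm (R b z)"
    using assms a norm_R[OF a, of "R b z"] 
    by (intro add_left_mono mult_mono) auto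
  also have "\<dots> = 2 * (a / b) * norm (b *\<^sub>R R b z)"
    using assms by simp
  finally show ?thesis .
qed

text \<open>
  This is the square root of \<open>a (g, (a + TS)\<^sup>-\<^sup>1 g)\<close>, the quantity in the stopping rule.  Writing it
  as the norm of a pair depending linearly on \<open>g\<close> gives the triangle inequality without square roots
  of operators.
\<close>

definition res_norm :: "real \<Rightarrow> 'b \<Rightarrow> real" where
  "res_norm a g = norm (a *\<^sub>R dual.R a g, sqrt a *\<^sub>R S (dual.R a g))"

lemma res_norm_sq:
  assumes "a > 0" shows "(res_norm a g)\<^sup>2 = a * (g \<bullet> reg_inv a (T \<circ> S) g)"
proof -
  have "(res_norm a g)\<^sup>2 = a * (a * (norm (dual.R a g))\<^sup>2 + (norm (S (dual.R a g)))\<^sup>2)"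
    using assms by (simp add: res_norm_def norm_Pair power_mult_distrib distrib_left)
       (simp add: power2_eq_square)
  then show ?thesis using dual.energy[OF assms, of g] by (simp add: dual.R_def)
qed

lemma res_norm_nonneg [simp]: "0 \<le> res_norm a g"
  by (simp add: res_norm_def)

lemma res_norm_triangle:
  assumes "a > 0" shows "res_norm a (g + h) \<le> res_norm a g + res_norm a h"
  using norm_triangle_ineq[of "(a *\<^sub>R dual.R a g, sqrt a *\<^sub>R S (dual.R a g))"
      "(a *\<^sub>R dual.R a h, sqrt a *\<^sub>R S (dual.R a h))"] assms
  by (simp add: res_norm_def dual.R_add S.add scaleR_add_right)

lemma res_norm_le_norm:
  assumes "a > 0" shows "res_norm a g \<le> norm g"
proof -
  have "(res_norm a g)\<^sup>2 \<le> norm g * (a * norm (dual.R a g))"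
    using res_norm_sq[OF assms, of g] norm_cauchy_schwarz[of g "dual.R a g"] assms
    by (simp add: dual.R_def mult_ac)
  also have "\<dots> \<le> norm g * norm g"
    by (intro mult_left_mono dual.norm_R assms) auto
  finally show ?thesis by (metis norm_ge_zero power2_eq_square power2_le_imp_le)
qed

lemma res_norm_components:
  assumes "a > 0"
  shows "a * norm (dual.R a g) \<le> res_norm a g"
    and "sqrt a * norm (S (dual.R a g)) \<le> res_norm a g"
  using assms norm_fst_le[of "a *\<^sub>R dual.R a g" "sqrt a *\<^sub>R S (dual.R a g)"]
    norm_snd_le[of "sqrt a *\<^sub>R S (dual.R a g)" "a *\<^sub>R dual.R a g"]
  by (auto simp: res_norm_def)

lemma res_norm_T:
  assumes "a > 0" shows "res_norm a (T x) \<le> sqrt a * norm x"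
proof -
  have "res_norm a (T x) * res_norm a (T x) = a * (x \<bullet> S (dual.R a (T x)))"
    using res_norm_sq[OF assms, of "T x"] by (simp add: power2_eq_square dual.R_def adj)
  also have "\<dots> \<le> a * (norm x * norm (S (dual.R a (T x))))"
    using assms by (intro mult_left_mono norm_cauchy_schwarz) auto
  also have "\<dots> = (sqrt a * norm x) * (sqrt a * norm (S (dual.R a (T x))))"
    using assms by (simp add: mult_ac)
  also have "\<dots> \<le> (sqrt a * norm x) * res_norm a (T x)"
    using assms res_norm_components(2)[OF assms] by (intro mult_left_mono) auto
  finally show ?thesis
    by (rule le_if_mult_self_le) (use assms in auto)
qed

text \<open>
  The function \<open>\<surd>b \<surd>t/(b + t)\<close> is bounded by a multiple of \<open>(a/(a + t))\<^sup>1\<^sup>/\<^sup>2\<close> for all \<open>b \<le> a\<close>.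
  A residual that is small in the weighted norm for \<open>a\<close> therefore has an effect of order \<open>1/\<surd>b\<close> for
  every smaller parameter \<open>b\<close> too.  The proof writes \<open>g = (a + TS) z\<close> and bounds the two parts
  of \<open>(b + ST)\<^sup>-\<^sup>1 (a + ST) S z\<close> by the two components of the norm.
\<close>

lemma norm_R_S_le_res_norm:
  assumes "0 < b" "b \<le> a"
  shows "sqrt b * norm (R b (S g)) \<le> 3 / 2 * res_norm a g"
proof -
  have a: "a > 0" using assms by simp
  define z where "z = dual.R a g"
  have g: "g = a *\<^sub>R z + T (S z)" by (simp add: z_def dual.R_eqn a)
  have "b *\<^sub>R (S z + (a - b) *\<^sub>R R b (S z)) + S (T (S z + (a - b) *\<^sub>R R b (S z)))
      = b *\<^sub>R S z + S (T (S z)) + (a - b) *\<^sub>R (b *\<^sub>R R b (S z) + S (T (R b (S z))))"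
    by (simp add: T.add S.add T.scaleR S.scaleR scaleR_add_right mult_ac)
  also have "\<dots> = S g"
    by (simp add: R_eqn assms) (simp add: g S.add S.scaleR algebra_simps)
  finally have "R b (S g) = S z + (a - b) *\<^sub>R R b (S z)"
    by (intro R_eqI assms)
  then have "sqrt b * norm (R b (S g)) \<le> sqrt b * (norm (S z) + (a - b) * norm (R b (S z)))"
    using norm_triangle_ineq[of "S z" "(a - b) *\<^sub>R R b (S z)"] assms by (intro mult_left_mono) auto
  also have "\<dots> = sqrt b * norm (S z) + (a - b) * (sqrt b * norm (R b (S z)))"
    by (simp add: algebra_simps)
  also have "\<dots> \<le> sqrt a * norm (S z) + a * (norm z / 2)"
    using assms norm_R_S[OF assms(1), of z]
    by (intro add_mono mult_mono mult_right_mono) auto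
  also have "\<dots> \<le> 3 / 2 * res_norm a g"
    using res_norm_components[OF a, of g] by (simp add: z_def)
  finally show ?thesis .
qed

end

text \<open>
  With \<open>r\<^sub>0 = a(a + S\<^sub>0T\<^sub>0)\<^sup>-\<^sup>1 S\<^sub>0 v\<close>, the difference is the inverse at \<open>T\<^sub>1\<close> applied to
  \<open>S\<^sub>1(T\<^sub>0 - T\<^sub>1) r\<^sub>0 + (S\<^sub>0 - S\<^sub>1) T\<^sub>0 r\<^sub>0\<close>.  The source condition yields \<open>\<parallel>r\<^sub>0\<parallel> \<le> \<surd>a \<parallel>v\<parallel>/2\<close> and
  \<open>\<parallel>T\<^sub>0 r\<^sub>0\<parallel> \<le> a\<parallel>v\<parallel>\<close>, which exactly compensate the factors \<open>1/(2\<surd>a)\<close> and \<open>1/a\<close>; the bound is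
  uniform in \<open>a\<close>.
\<close>

lemma scaled_resolvent_perturbation:
  assumes "adjoint_pair T0 S0" "adjoint_pair T1 S1" "a > 0"
    and d: "\<And>x. norm (T1 x - T0 x) \<le> d * norm x" "d \<ge> 0"
  shows "norm (a *\<^sub>R adjoint_pair.R T1 S1 a (S0 v) - a *\<^sub>R adjoint_pair.R T0 S0 a (S0 v))
      \<le> 5 / 4 * d * norm v"
proof -
  interpret P0: adjoint_pair T0 S0 by fact
  interpret P1: adjoint_pair T1 S1 by fact
  have S: "norm (S1 y - S0 y) \<le> d * norm y" for y
    using adjoint_pair.norm_S_le[OF adjoint_pair_diff[OF assms(2,1)] d] .
  define r0 where "r0 = a *\<^sub>R P0.R a (S0 v)"
  have r0: "a *\<^sub>R r0 + S0 (T0 r0) = a *\<^sub>R S0 v"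
    using P0.R_eqn[OF assms(3), of "S0 v"]
    unfolding r0_def linear_cmul[OF bounded_linear.linear[OF P0.T]] linear_cmul[OF bounded_linear.linear[OF P0.S]] by (metis scaleR_add_right)
  define f1 where "f1 = S1 (T0 r0 - T1 r0)"
  define f2 where "f2 = S0 (T0 r0) - S1 (T0 r0)"
  have "a *\<^sub>R r0 + S1 (T1 r0) = a *\<^sub>R S0 v - f1 - f2"
    unfolding f1_def f2_def P1.S_diff using r0 by (simp add: algebra_simps)
  then have "r0 = P1.R a (a *\<^sub>R S0 v - f1 - f2)"
    using P1.R_eqI[OF assms(3)] by metis
  then have eq: "a *\<^sub>R P1.R a (S0 v) - r0 = P1.R a f1 + P1.R a f2"
    by (simp add: P1.R_diff P1.R_scaleR assms(3))
  have r0n: "norm r0 \<le> sqrt a * norm v / 2"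
  proof -
    have "norm r0 = sqrt a * (sqrt a * norm (P0.R a (S0 v)))"
      using assms(3) by (simp add: r0_def flip: mult.assoc)
    also have "\<dots> \<le> sqrt a * (norm v / 2)"
      using P0.norm_R_S[OF assms(3), of v] by (intro mult_left_mono) (auto simp: assms(3) less_imp_le)
    finally show ?thesis by simp
  qed
  have f1: "norm (P1.R a f1) \<le> d * norm v / 4"
  proof -
    have "2 * sqrt a * norm (P1.R a f1) \<le> norm (T0 r0 - T1 r0)"
      unfolding f1_def by (rule P1.norm_R_S[OF assms(3)])
    also have "\<dots> \<le> d * (sqrt a * norm v / 2)"
      using d(1)[of r0] mult_left_mono[OF r0n d(2)] by (simp add: norm_minus_commute)
    finally have "sqrt a * norm (P1.R a f1) \<le> sqrt a * (d * norm v / 4)" by (simp add: mult_ac)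
    then show ?thesis using assms(3) by simp
  qed
  have f2: "norm (P1.R a f2) \<le> d * norm v"
  proof -
    have "a * norm (P1.R a f2) \<le> norm f2" by (rule P1.norm_R[OF assms(3)])
    also have "\<dots> \<le> d * norm (T0 r0)"
      using S[of "T0 r0"] by (simp add: f2_def norm_minus_commute)
    also have "\<dots> \<le> d * (a * norm v)"
      using P0.norm_T_R_S[OF assms(3), of v] assms(3) d(2)
      by (intro mult_left_mono) (auto simp: r0_def linear_cmul[OF bounded_linear.linear[OF P0.T]])
    finally have "a * norm (P1.R a f2) \<le> a * (d * norm v)"
      by (simp add: mult_ac)
    then show ?thesis using assms(3) by simp
  qed
  show ?thesis
    using norm_triangle_ineq[of "P1.R a f1" "P1.R a f2"] f1 f2 eq by (simp add: r0_def)
qed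

section \<open>Polynomials of operators\<close>

lemma poly_op_upto:
  assumes "degree p \<le> n"
  shows "poly_op p A x = (\<Sum>i\<le>n. coeff p i *\<^sub>R (A ^^ i) x)"
  unfolding poly_op_def using assms
  by (intro sum.mono_neutral_left) (auto simp: coeff_eq_0)

lemma poly_op_0 [simp]: "poly_op 0 A x = 0"
  by (simp add: poly_op_def)

lemma poly_op_pCons: "poly_op (pCons a p) A x = a *\<^sub>R x + poly_op p A (A x)"
proof -
  have "degree (pCons a p) \<le> Suc (degree p)" by (rule degree_pCons_le)
  then have "poly_op (pCons a p) A x
      = (\<Sum>i\<le>Suc (degree p). coeff (pCons a p) i *\<^sub>R (A ^^ i) x)"
    by (rule poly_op_upto)
  then show ?thesis
    by (simp add: sum.atMost_Suc_shift poly_op_def funpow_swap1 del: sum.atMost_Suc)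
qed

lemma poly_op_add: "poly_op (p + q) A x = poly_op p A x + poly_op q A x"
proof -
  define n where "n = max (degree p) (degree q)"
  have "degree p \<le> n" "degree q \<le> n" "degree (p + q) \<le> n"
    using degree_add_le_max[of p q] by (auto simp: n_def)
  then show ?thesis by (simp add: poly_op_upto scaleR_add_left sum.distrib)
qed

lemma poly_op_smult: "poly_op (smult c p) A x = c *\<^sub>R poly_op p A x"
proof -
  have "degree (smult c p) \<le> degree p" by simp
  from poly_op_upto[OF this] show ?thesis by (simp add: poly_op_def scaleR_sum_right)
qed

lemma poly_op_diff: "poly_op (p - q) A x = poly_op p A x - poly_op q A x"
  using poly_op_add[of p "smult (-1) q" A x] poly_op_smult[of "-1" q A x] by simp

lemma smult_sum_right: "smult c (\<Sum>i\<in>I. p i) = (\<Sum>i\<in>I. smult c (p i))"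
  by (induction I rule: infinite_finite_induct) (simp_all add: smult_add_right)

lemma poly_op_linear:
  assumes "linear A"
  shows "poly_op p A (x + y) = poly_op p A x + poly_op p A y"
    and "poly_op p A (c *\<^sub>R x) = c *\<^sub>R poly_op p A x"
    and "poly_op p A (A x) = A (poly_op p A x)"
proof -
  interpret linear A by fact
  show "poly_op p A (x + y) = poly_op p A x + poly_op p A y"
    by (induction p arbitrary: x y) (simp_all add: poly_op_pCons add scaleR_add_right)
  show "poly_op p A (c *\<^sub>R x) = c *\<^sub>R poly_op p A x"
    by (induction p arbitrary: x) (simp_all add: poly_op_pCons scale scaleR_add_right mult_ac)
  show "poly_op p A (A x) = A (poly_op p A x)"
    by (induction p arbitrary: x) (simp_all add: poly_op_pCons zero add scale)
qed

lemma poly_op_mult: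
  assumes "linear A"
  shows "poly_op (p * q) A x = poly_op p A (poly_op q A x)"
  by (induction p arbitrary: x)
     (simp_all add: poly_op_pCons poly_op_add poly_op_smult poly_op_linear(3)[OF assms])

text \<open>
  The left fraction is the Bernstein coefficient of a monomial; the bound shows that, uniformly in
  \<open>k\<close>, it is asymptotically the value of the monomial at the node \<open>k/n\<close>.
\<close>

lemma binomial_ratio_near_power:
  assumes "k \<le> n" "2 * j < n"
  shows "\<bar>real (k choose j) / real (n choose j) - (real k / real n) ^ j\<bar>
      \<le> real j * (real j / (real n - real j))"
proof -
  define z where "z i = (real k - real i) / (real n - real i)" for i
  have "real (k choose j) / real (n choose j) = (\<Prod>i\<in>{0..<j}. z i)"
    by (simp add: binomial_gbinomial gbinomial_prod_rev z_def prod_dividef)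
  moreover have "(real k / real n) ^ j = (\<Prod>i\<in>{0..<j}. real k / real n)" by simp
  ultimately have "\<bar>real (k choose j) / real (n choose j) - (real k / real n) ^ j\<bar>
      \<le> (\<Sum>i\<in>{0..<j}. \<bar>z i - real k / real n\<bar>)"
    using norm_prod_diff[of "{0..<j}" z "\<lambda>_. real k / real n"] assms
    by (auto simp: z_def abs_le_iff divide_simps)
  also have "\<dots> \<le> (\<Sum>i\<in>{0..<j}. real j / (real n - real j))"
  proof (rule sum_mono)
    fix i assume "i \<in> {0..<j}"
    then have i: "real i \<le> real j" "2 * real j < real n" "real k \<le> real n"
      using assms by auto
    have "z i - real k / real n = - (real i * (real n - real k) / (real n * (real n - real i)))"
      using i by (simp add: z_def field_simps)
    then have "\<bar>z i - real k / real n\<bar> = real i / (real n - real i) * ((real n - real k) / real n)"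
      using i by (simp add: abs_mult abs_divide)
    also have "\<dots> \<le> real j / (real n - real j) * 1"
      using i by (intro mult_mono frac_le divide_nonneg_nonneg) (auto simp: divide_simps)
    finally show "\<bar>z i - real k / real n\<bar> \<le> real j / (real n - real j)" by simp
  qed
  finally show ?thesis by simp
qed

text \<open>
  Expand \<open>(X + Y)\<^bsup>n-j\<^esup>\<close> by the binomial theorem and use
  \<open>(n choose k) (k choose j) = (n choose j) ((n - j) choose (k - j))\<close>.  With \<open>X = t\<close> and
  \<open>Y = M - t\<close> this is the exact expansion of \<open>M\<^bsup>n-j\<^esup>t\<^sup>j\<close> in Bernstein polynomials of degree \<open>n\<close>.
\<close>

lemma monomial_Bernstein_expansion:
  fixes X Y :: "real poly"
  assumes "j \<le> n"
  shows "(X + Y) ^ (n - j) * X ^ j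
      = (\<Sum>k\<le>n. smult (real (n choose k) * (real (k choose j) / real (n choose j))) (X ^ k * Y ^ (n - k)))"
proof -
  have nj: "real (n choose j) > 0" using assms by simp
  have "(\<Sum>k\<le>n. smult (real (n choose k) * (real (k choose j) / real (n choose j))) (X ^ k * Y ^ (n - k)))
      = (\<Sum>k\<in>{j..n}. smult (real ((n - j) choose (k - j))) (X ^ k * Y ^ (n - k)))"
  proof (rule sum.mono_neutral_cong_right)
    fix k assume "k \<in> {j..n}"
    then have "real (n choose k) * real (k choose j) = real (n choose j) * real ((n - j) choose (k - j))"
      using choose_mult[of j k n] by (metis atLeastAtMost_iff of_nat_mult)
    then show "smult (real (n choose k) * (real (k choose j) / real (n choose j))) (X ^ k * Y ^ (n - k))
        = smult (real ((n - j) choose (k - j))) (X ^ k * Y ^ (n - k))"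
      using nj by simp
  qed auto
  also have "\<dots> = (\<Sum>i\<le>n - j. smult (real ((n - j) choose i)) (X ^ (i + j) * Y ^ (n - j - i)))"
    using assms
    by (intro sum.reindex_bij_witness[of _ "\<lambda>i. i + j" "\<lambda>k. k - j"]) auto
  also have "\<dots> = (\<Sum>i\<le>n - j. of_nat ((n - j) choose i) * X ^ i * Y ^ (n - j - i)) * X ^ j"
    unfolding sum_distrib_right
    by (intro sum.cong) (simp_all add: power_add of_nat_poly mult_ac)
  finally show ?thesis by (simp add: binomial_ring)
qed

locale nonneg_selfadjoint =
  fixes A :: "'a::{real_inner,banach} \<Rightarrow> 'a" and M :: real
  assumes linear: "linear A" and selfadj: "\<And>x y. A x \<bullet> y = x \<bullet> A y"
    and nonneg: "\<And>x. 0 \<le> A x \<bullet> x" and upper: "\<And>x. A x \<bullet> x \<le> M * (norm x)\<^sup>2" and M: "M > 0"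
begin

lemma poly_op_selfadj: "poly_op p A x \<bullet> y = x \<bullet> poly_op p A y"
  by (induction p arbitrary: x y)
     (simp_all add: poly_op_pCons inner_left_distrib inner_right_distrib poly_op_linear(3)[OF linear] selfadj)

definition psd :: "real poly \<Rightarrow> bool" where
  "psd p \<longleftrightarrow> (\<forall>z. 0 \<le> poly_op p A z \<bullet> z)"

lemma psd_add: "psd p \<Longrightarrow> psd q \<Longrightarrow> psd (p + q)"
  by (simp add: psd_def poly_op_add inner_left_distrib)

lemma psd_smult: "c \<ge> 0 \<Longrightarrow> psd p \<Longrightarrow> psd (smult c p)"
  by (simp add: psd_def poly_op_smult)

lemma psd_sum: "(\<And>i. i \<in> I \<Longrightarrow> psd (p i)) \<Longrightarrow> psd (\<Sum>i\<in>I. p i)"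
  by (induction I rule: infinite_finite_induct) (auto intro: psd_add simp: psd_def[of 0])

lemma psd_conj: "psd c \<Longrightarrow> psd (s * c * s)"
  by (simp add: psd_def poly_op_mult[OF linear] poly_op_selfadj[of s])

lemma psd_smult_cancel: "c > 0 \<Longrightarrow> psd (smult c p) \<Longrightarrow> psd p"
  by (simp add: psd_def poly_op_smult zero_le_mult_iff)

abbreviation X :: "real poly" where "X \<equiv> [:0, 1:]"
abbreviation Y :: "real poly" where "Y \<equiv> [:M, -1:]"

lemma psd_1: "psd 1"
  unfolding one_pCons by (simp add: psd_def poly_op_pCons)

lemma psd_X: "psd X"
  by (simp add: psd_def poly_op_pCons nonneg)

lemma psd_Y: "psd Y"
  using upper by (simp add: psd_def poly_op_pCons inner_diff_left power2_norm_eq_inner)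

text \<open>
  A product of commuting nonnegative operators, made explicit through
  \<open>M XY = (X + Y) XY = X\<^sup>2Y + XY\<^sup>2\<close>.
\<close>

lemma psd_XY: "psd (X * Y)"
proof -
  have "smult M (X * Y) = X * Y * X + Y * X * Y" by (simp add: algebra_simps)
  then show ?thesis
    using psd_add[OF psd_conj[OF psd_Y, of X] psd_conj[OF psd_X, of Y]] psd_smult_cancel[OF M] by metis
qed

text \<open>
  Split off the largest squares: the remaining factor is one of \<open>1\<close>, \<open>X\<close>, \<open>Y\<close>, \<open>XY\<close>.
\<close>

lemma psd_powers: "psd (X ^ k * Y ^ m)"
proof -
  define s where "s = X ^ (k div 2) * Y ^ (m div 2)"
  define c where "c = X ^ (k mod 2) * Y ^ (m mod 2)"
  have "X ^ k = X ^ (k div 2) * X ^ (k div 2) * X ^ (k mod 2)"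
       "Y ^ m = Y ^ (m div 2) * Y ^ (m div 2) * Y ^ (m mod 2)"
    unfolding power_add[symmetric] by (rule arg_cong[where f = "(^) _"], presburger)+
  then have "X ^ k * Y ^ m = s * c * s"
    unfolding s_def c_def by (simp only: mult_ac)
  moreover have "psd c"
    using psd_1 psd_X psd_Y psd_XY
    by (cases "k mod 2 = 0"; cases "m mod 2 = 0") (simp_all add: c_def mod2_eq_if split: if_splits)
  ultimately show ?thesis using psd_conj by simp
qed

text \<open>
  The Bernstein coefficients of \<open>q\<close> of degree \<open>n\<close> differ from the values of \<open>q\<close> at the nodes by at
  most \<open>err n\<close>, so \<open>q + err n\<close> has nonnegative coefficients and \<open>psd_powers\<close> applies.  Letting
  \<open>n\<close> tend to infinity removes the error.
\<close>

theorem psd_if_nonneg_on_interval: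
  assumes q: "\<And>t. 0 \<le> t \<Longrightarrow> t \<le> M \<Longrightarrow> 0 \<le> poly q t"
  shows "psd q"
proof -
  define d where "d = degree q"
  define err where "err n = (\<Sum>j\<le>d. \<bar>coeff q j * M ^ j\<bar> * (real j * (real j / (real n - real j))))" for n
  have approx: "psd (q + [:err n:])" if n: "2 * d < n" for n
  proof -
    define b where "b k = (\<Sum>j\<le>d. coeff q j * M ^ j * (real (k choose j) / real (n choose j)))" for k
    have b: "0 \<le> b k + err n" if k: "k \<le> n" for k
    proof -
      have "poly q (M * (real k / real n)) - b k
          = (\<Sum>j\<le>d. coeff q j * M ^ j * ((real k / real n) ^ j - real (k choose j) / real (n choose j)))"
        unfolding poly_altdef b_def d_def sum_subtractf[symmetric]
        by (simp only: power_mult_distrib right_diff_distrib mult.assoc)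
      also have "\<dots> \<le> err n"
        unfolding err_def
      proof (rule sum_mono)
        fix j assume "j \<in> {..d}"
        then have "2 * j < n" using n by simp
        from binomial_ratio_near_power[OF k this]
        show "coeff q j * M ^ j * ((real k / real n) ^ j - real (k choose j) / real (n choose j))
          \<le> \<bar>coeff q j * M ^ j\<bar> * (real j * (real j / (real n - real j)))"
          by - (rule order_trans[OF abs_ge_self], unfold abs_mult, intro mult_left_mono, simp_all add: abs_minus_commute)
      qed
      moreover have "0 \<le> poly q (M * (real k / real n))"
        using k n M by (intro q) (auto simp: divide_simps)
      ultimately show ?thesis by simp
    qed
    have XY: "X + Y = [:M:]" by simp
    have mono: "smult (M ^ n) (monom 1 j) = smult (M ^ j) ((X + Y) ^ (n - j) * X ^ j)" if "j \<le> d" for j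
    proof -
      have "M ^ j * M ^ (n - j) = M ^ n" using that n by (simp flip: power_add)
      then show ?thesis unfolding XY by (simp add: poly_const_pow monom_altdef)
    qed
    have "smult (M ^ n) q = (\<Sum>j\<le>d. smult (coeff q j) (smult (M ^ n) (monom 1 j)))"
      by (subst poly_as_sum_of_monoms[of q, symmetric])
         (simp add: d_def smult_sum_right smult_monom mult_ac)
    also have "\<dots> = (\<Sum>j\<le>d. \<Sum>k\<le>n. smult (coeff q j * M ^ j * (real (n choose k) * (real (k choose j) / real (n choose j))))
        (X ^ k * Y ^ (n - k)))"
    proof (intro sum.cong refl)
      fix j assume "j \<in> {..d}"
      then have j: "j \<le> d" "j \<le> n" using n by auto
      show "smult (coeff q j) (smult (M ^ n) (monom 1 j))
        = (\<Sum>k\<le>n. smult (coeff q j * M ^ j * (real (n choose k) * (real (k choose j) / real (n choose j))))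
            (X ^ k * Y ^ (n - k)))"
        by (simp only: mono[OF j(1)] monomial_Bernstein_expansion[OF j(2)] smult_sum_right smult_smult mult.assoc)
    qed
    also have "\<dots> = (\<Sum>k\<le>n. smult (real (n choose k) * b k) (X ^ k * Y ^ (n - k)))"
      by (subst sum.swap) (simp add: b_def sum_distrib_left smult_sum mult_ac)
    finally have q_eq: "smult (M ^ n) q = (\<Sum>k\<le>n. smult (real (n choose k) * b k) (X ^ k * Y ^ (n - k)))" .
    have "[:M ^ n:] = (\<Sum>k\<le>n. smult (real (n choose k)) (X ^ k * Y ^ (n - k)))"
      using monomial_Bernstein_expansion[of 0 n X Y] unfolding XY by (simp add: poly_const_pow)
    moreover have "smult (M ^ n) [:err n:] = smult (err n) [:M ^ n:]" by (simp add: mult.commute)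
    ultimately have "smult (M ^ n) [:err n:] = (\<Sum>k\<le>n. smult (real (n choose k) * err n) (X ^ k * Y ^ (n - k)))"
      by (simp only: smult_sum_right smult_smult mult.commute)
    then have "smult (M ^ n) (q + [:err n:])
        = (\<Sum>k\<le>n. smult (real (n choose k) * (b k + err n)) (X ^ k * Y ^ (n - k)))"
      unfolding smult_add_right q_eq by (simp only: sum.distrib[symmetric] smult_add_left distrib_left)
    moreover have "psd \<dots>" using b by (intro psd_sum psd_smult psd_powers) auto
    ultimately show ?thesis using psd_smult_cancel[of "M ^ n"] M by simp
  qed
  have "0 \<le> poly_op q A z \<bullet> z" for z
  proof -
    have "err \<longlonglongrightarrow> (\<Sum>j\<le>d. \<bar>coeff q j * M ^ j\<bar> * (real j * 0))"
      unfolding err_def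
    proof (intro tendsto_sum tendsto_mult_left)
      fix j :: nat
      have "filterlim (\<lambda>n. - real j + real n) at_top sequentially"
        by (intro filterlim_tendsto_add_at_top[OF tendsto_const] filterlim_real_sequentially)
      then show "(\<lambda>n. real j / (real n - real j)) \<longlonglongrightarrow> 0"
        by (intro tendsto_divide_0[OF tendsto_const] filterlim_at_top_imp_at_infinity) simp
    qed
    then have "(\<lambda>n. poly_op q A z \<bullet> z + err n * (z \<bullet> z)) \<longlonglongrightarrow> poly_op q A z \<bullet> z + 0 * (z \<bullet> z)"
      by (intro tendsto_intros) simp
    moreover have "\<forall>\<^sub>F n in sequentially. 0 \<le> poly_op q A z \<bullet> z + err n * (z \<bullet> z)"
      using eventually_gt_at_top[of "2 * d"]
    proof eventually_elim
      case (elim n)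
      from approx[OF this] show ?case
        by (auto simp: psd_def poly_op_add poly_op_pCons inner_left_distrib)
    qed
    ultimately have "0 \<le> poly_op q A z \<bullet> z + 0 * (z \<bullet> z)"
      by (rule tendsto_lowerbound) simp
    then show ?thesis by simp
  qed
  then show ?thesis by (simp add: psd_def)
qed

text \<open>
  Nonnegativity of \<open>q\<^sup>2 - p\<^sup>2\<close> on the interval is transferred to the operator.  With a constant \<open>q\<close>
  this is the supremum bound on \<open>p(A)\<close>; with linear \<open>q\<close> it bounds \<open>p(A)(a + A)\<^sup>-\<^sup>1\<close> without any
  approximation of \<open>1/(a + t)\<close>.
\<close>

lemma poly_op_norm_mono:
  assumes "\<And>t. 0 \<le> t \<Longrightarrow> t \<le> M \<Longrightarrow> \<bar>poly p t\<bar> \<le> \<bar>poly q t\<bar>"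
  shows "norm (poly_op p A z) \<le> norm (poly_op q A z)"
proof -
  have "psd (q * q - p * p)"
    using assms by (intro psd_if_nonneg_on_interval) (simp add: abs_le_square_iff flip: power2_eq_square)
  then have "poly_op p A z \<bullet> poly_op p A z \<le> poly_op q A z \<bullet> poly_op q A z"
    by (auto simp: psd_def poly_op_diff poly_op_mult[OF linear] inner_diff_left poly_op_selfadj)
  then show ?thesis by (simp add: norm_le)
qed

end

section \<open>Continuous functional calculus and fractional powers\<close>

lemma polynomial_approximation:
  fixes f :: "real \<Rightarrow> real"
  assumes "continuous_on {a..b} f" "e > 0"
  obtains p :: "real poly" where "\<And>t. t \<in> {a..b} \<Longrightarrow> \<bar>poly p t - f t\<bar> \<le> e"
proof -
  obtain g where g: "real_polynomial_function g" "\<And>t. t \<in> {a..b} \<Longrightarrow> \<bar>f t - g t\<bar> < e"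
    using Stone_Weierstrass_real_polynomial_function[OF _ assms] by (metis compact_Icc)
  obtain c n where "g = (\<lambda>x. \<Sum>i\<le>n. c i * x ^ i)"
    using g(1) real_polynomial_function_iff_sum by auto
  then have "poly (\<Sum>i\<le>n. monom (c i) i) t = g t" for t
    by (simp add: poly_sum poly_monom)
  then show ?thesis using g(2) by (intro that[of "\<Sum>i\<le>n. monom (c i) i"]) (force simp: abs_minus_commute)
qed

text \<open>
  The Bernstein argument divides by the length of the interval, so the operator \<open>A = 0\<close> is treated
  separately.
\<close>

lemma poly_op_norm_mono_onorm:
  fixes A :: "'a::{real_inner,banach} \<Rightarrow> 'a"
  assumes A: "bounded_linear A" and selfadj: "\<And>x y. A x \<bullet> y = x \<bullet> A y" and nonneg: "\<And>x. 0 \<le> A x \<bullet> x"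
    and pq: "\<And>t. t \<in> {0..onorm A} \<Longrightarrow> \<bar>poly p t\<bar> \<le> \<bar>poly q t\<bar>"
  shows "norm (poly_op p A z) \<le> norm (poly_op q A z)"
proof (cases "onorm A = 0")
  case True
  then have "A x = 0" for x using onorm[OF A, of x] by simp
  then have "poly_op r A x = poly r 0 *\<^sub>R x" for r x
    by (induction r arbitrary: x) (simp_all add: poly_op_pCons)
  then show ?thesis using pq[of 0] True by (simp add: mult_right_mono)
next
  case False
  have "A x \<bullet> x \<le> onorm A * (norm x)\<^sup>2" for x
    using norm_cauchy_schwarz[of "A x" x] mult_right_mono[OF onorm[OF A, of x] norm_ge_zero[of x]]
    by (simp add: power2_eq_square mult_ac)
  then interpret nonneg_selfadjoint A "onorm A"
    using onorm_pos_le[OF A] False selfadj nonneg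
    by (simp add: nonneg_selfadjoint_def bounded_linear.linear[OF A])
  show ?thesis using pq by (intro poly_op_norm_mono) auto
qed

text \<open>
  Polynomials converging uniformly to \<open>f\<close> have pointwise Cauchy values at \<open>A\<close>, by the supremum bound.
  The limit satisfies the description in the definition of \<open>fun_calc\<close>, and any other operator
  satisfying it is the limit of the same sequence.
\<close>

lemma fun_calc_approx:
  fixes A :: "'a::{real_inner,banach} \<Rightarrow> 'a"
  assumes A: "bounded_linear A" and selfadj: "\<And>x y. A x \<bullet> y = x \<bullet> A y" and nonneg: "\<And>x. 0 \<le> A x \<bullet> x"
    and f: "continuous_on {0..onorm A} f"
    and p: "\<And>t. t \<in> {0..onorm A} \<Longrightarrow> \<bar>poly p t - f t\<bar> \<le> \<epsilon>"
  shows "norm (poly_op p A x - fun_calc f A x) \<le> \<epsilon> * norm x"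
proof -
  define calc where "calc B \<longleftrightarrow> (\<forall>p \<epsilon>. (\<forall>t\<in>{0..onorm A}. \<bar>poly p t - f t\<bar> \<le> \<epsilon>) \<longrightarrow>
                               (\<forall>x. norm (poly_op p A x - B x) \<le> \<epsilon> * norm x))"
    for B :: "'a \<Rightarrow> 'a"
  have diff: "norm (poly_op p A x - poly_op q A x) \<le> e * norm x"
    if "\<And>t. t \<in> {0..onorm A} \<Longrightarrow> \<bar>poly p t - poly q t\<bar> \<le> e" for p q e x
  proof -
    have "e \<ge> 0" using that[of 0] onorm_pos_le[OF A] by (auto intro: order_trans[OF abs_ge_zero])
    then show ?thesis
      using poly_op_norm_mono_onorm[OF A selfadj nonneg, of "p - q" "[:e:]" x] that
      by (simp add: poly_op_diff poly_op_pCons)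
  qed
  have "\<exists>q. \<forall>t\<in>{0..onorm A}. \<bar>poly q t - f t\<bar> \<le> inverse (real (Suc n))" for n
    by (rule polynomial_approximation[OF f, of "inverse (real (Suc n))"]) (simp, blast)
  then obtain P where P: "\<And>n t. t \<in> {0..onorm A} \<Longrightarrow> \<bar>poly (P n) t - f t\<bar> \<le> inverse (real (Suc n))"
    by metis
  have PP: "norm (poly_op (P m) A x - poly_op (P n) A x)
      \<le> (inverse (real (Suc m)) + inverse (real (Suc n))) * norm x" for m n x
    using P[of _ m] P[of _ n] by (intro diff) fastforce
  have "Cauchy (\<lambda>n. poly_op (P n) A x)" for x
  proof (rule metric_CauchyI)
    fix e :: real assume e: "e > 0"
    have "(\<lambda>n. inverse (real (Suc n)) * norm x) \<longlonglongrightarrow> 0 * norm x"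
      by (intro tendsto_intros LIMSEQ_inverse_real_of_nat)
    then have "\<forall>\<^sub>F n in sequentially. inverse (real (Suc n)) * norm x < e / 2"
      using e by (intro order_tendstoD) auto
    then obtain N where N: "\<And>n. n \<ge> N \<Longrightarrow> inverse (real (Suc n)) * norm x < e / 2"
      by (auto simp: eventually_sequentially)
    show "\<exists>M. \<forall>m\<ge>M. \<forall>n\<ge>M. dist (poly_op (P m) A x) (poly_op (P n) A x) < e"
    proof (intro exI[of _ N] allI impI)
      fix m n assume "N \<le> m" "N \<le> n"
      from N[OF this(1)] N[OF this(2)] PP[of m x n]
      show "dist (poly_op (P m) A x) (poly_op (P n) A x) < e"
        unfolding dist_norm distrib_right by linarith
    qed
  qed
  then have "\<exists>B. \<forall>x. (\<lambda>n. poly_op (P n) A x) \<longlonglongrightarrow> B x"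
    unfolding convergent_eq_Cauchy[symmetric] by (intro choice allI)
  then obtain B where B: "\<And>x. (\<lambda>n. poly_op (P n) A x) \<longlonglongrightarrow> B x" by blast
  have "calc B"
    unfolding calc_def
  proof (intro allI impI)
    fix p \<epsilon> x assume p: "\<forall>t\<in>{0..onorm A}. \<bar>poly p t - f t\<bar> \<le> \<epsilon>"
    have lim1: "(\<lambda>n. norm (poly_op p A x - poly_op (P n) A x)) \<longlonglongrightarrow> norm (poly_op p A x - B x)"
      by (intro tendsto_intros B)
    have lim2: "(\<lambda>n. (\<epsilon> + inverse (real (Suc n))) * norm x) \<longlonglongrightarrow> (\<epsilon> + 0) * norm x"
      by (intro tendsto_intros LIMSEQ_inverse_real_of_nat)
    have "norm (poly_op p A x - poly_op (P n) A x) \<le> (\<epsilon> + inverse (real (Suc n))) * norm x" for n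
      using p P[of _ n] by (intro diff) fastforce
    then show "norm (poly_op p A x - B x) \<le> \<epsilon> * norm x"
      using LIMSEQ_le[OF lim1 lim2] by auto
  qed
  moreover have "B' = B" if "calc B'" for B'
  proof
    fix x :: 'a
    have "(\<lambda>n. inverse (real (Suc n)) * norm x) \<longlonglongrightarrow> 0 * norm x"
      by (intro tendsto_intros LIMSEQ_inverse_real_of_nat)
    then have lim: "(\<lambda>n. inverse (real (Suc n)) * norm x) \<longlonglongrightarrow> 0" by (simp only: mult_zero_left)
    have "\<forall>\<^sub>F n in sequentially. norm (poly_op (P n) A x - B' x) \<le> inverse (real (Suc n)) * norm x"
      using that P by (intro always_eventually allI) (auto simp: calc_def)
    from Lim_null_comparison[OF this lim] have "(\<lambda>n. poly_op (P n) A x - B' x) \<longlonglongrightarrow> 0" .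
    then have "(\<lambda>n. poly_op (P n) A x) \<longlonglongrightarrow> B' x"
      using Lim_null by blast
    then show "B' x = B x" using B LIMSEQ_unique by blast
  qed
  ultimately have "calc (THE B. calc B)" by (rule theI)
  then have "calc (fun_calc f A)" by (simp add: calc_def fun_calc_def)
  then show ?thesis using p by (auto simp: calc_def)
qed

lemma powr_qualification:
  fixes a t s :: real
  assumes "a > 0" "t \<ge> 0" "0 < s" "s \<le> 1"
  shows "a * t powr s \<le> a powr s * (a + t)"
proof (cases "t \<le> a")
  case True
  then have "t powr s \<le> a powr s" using assms by (intro powr_mono2) auto
  then have "a * t powr s \<le> a * a powr s" using assms by simp
  also have "\<dots> \<le> a powr s * (a + t)" using assms by (simp add: algebra_simps)
  finally show ?thesis .
next
  case False
  have "(t / a) powr s \<le> (t / a) powr 1" using False assms by (intro powr_mono) auto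
  then have "t powr s / a powr s \<le> t / a" using False assms by (simp add: powr_divide)
  then have "a * t powr s \<le> a powr s * t" using assms by (simp add: field_simps)
  also have "\<dots> \<le> a powr s * (a + t)" using assms by simp
  finally show ?thesis .
qed

text \<open>
  The qualification of Tikhonov regularisation, \<open>a t\<^sup>s/(a + t) \<le> a\<^sup>s\<close> for \<open>s \<le> 1\<close>, transferred to the
  operator through a polynomial \<open>p\<close> close to \<open>t\<^sup>s\<close>: on the interval
  \<open>a |p(t)| \<le> (a\<^sup>s + e)(a + t)\<close>, and the right side is a polynomial.
\<close>

lemma (in adjoint_pair) scaled_R_op_powr:
  assumes a: "a > 0" and s: "0 < s" "s \<le> 1"
  shows "norm (a *\<^sub>R R a (op_powr (S \<circ> T) s \<omega>)) \<le> a powr s * norm \<omega>"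
proof (rule field_le_epsilon)
  fix e' :: real assume e': "e' > 0"
  define e where "e = e' / (2 * (norm \<omega> + 1))"
  have e: "e > 0" "2 * e * norm \<omega> \<le> e'"
  proof -
    have "norm \<omega> + 1 > 0" by (simp add: add_nonneg_pos)
    then show "e > 0" "2 * e * norm \<omega> \<le> e'" using e' by (simp_all add: e_def field_simps)
  qed
  define A where "A = S \<circ> T"
  have A: "bounded_linear A" unfolding A_def comp_def by (rule bounded_linear_compose[OF S T])
  have selfadj: "A x \<bullet> y = x \<bullet> A y" for x y by (simp add: A_def adj' adj)
  have nonneg: "0 \<le> A x \<bullet> x" for x by (simp add: A_def adj')
  have cont: "continuous_on {0..onorm A} (\<lambda>t. t powr s)"
    using s by (intro continuous_on_powr' continuous_intros) auto
  obtain p where p: "\<And>t. t \<in> {0..onorm A} \<Longrightarrow> \<bar>poly p t - t powr s\<bar> \<le> e"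
    using polynomial_approximation[OF cont e(1)] by blast
  define z where "z = R a \<omega>"
  have z: "poly_op [:a, 1:] A z = \<omega>"
    using R_eqn[OF a, of \<omega>] by (simp add: poly_op_pCons A_def z_def)
  have "norm (poly_op (smult a p) A z) \<le> norm (poly_op (smult (a powr s + e) [:a, 1:]) A z)"
  proof (rule poly_op_norm_mono_onorm[OF A selfadj nonneg])
    fix t assume t: "t \<in> {0..onorm A}"
    have "\<bar>poly (smult a p) t\<bar> \<le> a * (t powr s + e)"
    proof -
      have "\<bar>poly p t\<bar> \<le> t powr s + e" using p[OF t] powr_ge_zero[of t s] by linarith
      then show ?thesis using a by (simp add: abs_mult)
    qed
    also have "\<dots> \<le> (a powr s + e) * (a + t)"
      
    proof -
      have "0 \<le> e * t" using t e by simp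
      then show ?thesis using powr_qualification[of a t s] a s t by (simp add: algebra_simps)
    qed
    also have "\<dots> \<le> \<bar>poly (smult (a powr s + e) [:a, 1:]) t\<bar>"
      by (rule order_trans[OF _ abs_ge_self]) (simp add: algebra_simps)
    finally show "\<bar>poly (smult a p) t\<bar> \<le> \<bar>poly (smult (a powr s + e) [:a, 1:]) t\<bar>" .
  qed
  also have "\<dots> = (a powr s + e) * norm \<omega>"
    using z e by (simp only: poly_op_smult norm_scaleR) simp
  finally have 1: "norm (a *\<^sub>R poly_op p A z) \<le> (a powr s + e) * norm \<omega>"
    by (simp add: poly_op_smult)
  have "a *\<^sub>R poly_op p A z + S (T (poly_op p A z)) = poly_op ([:a, 1:] * p) A z"
    by (simp only: poly_op_mult[OF bounded_linear.linear[OF A]] poly_op_pCons)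
       (simp add: A_def poly_op_0)
  also have "\<dots> = poly_op p A \<omega>"
    by (simp only: mult.commute[of _ p] poly_op_mult[OF bounded_linear.linear[OF A]] z)
  finally have 2: "R a (poly_op p A \<omega>) = poly_op p A z" by (rule R_eqI[OF a])
  have "a * norm (R a (poly_op p A \<omega> - op_powr A s \<omega>)) \<le> norm (poly_op p A \<omega> - op_powr A s \<omega>)"
    by (rule norm_R[OF a])
  also have "\<dots> \<le> e * norm \<omega>"
    unfolding op_powr_def by (rule fun_calc_approx[OF A selfadj nonneg cont p])
  finally have "norm (a *\<^sub>R poly_op p A z - a *\<^sub>R R a (op_powr A s \<omega>)) \<le> e * norm \<omega>"
    using a by (simp add: R_diff[OF a] 2 flip: scaleR_diff_right)
  with 1 e show "norm (a *\<^sub>R R a (op_powr (S \<circ> T) s \<omega>)) \<le> a powr s * norm \<omega> + e'"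
    using norm_triangle_sub[of "a *\<^sub>R R a (op_powr A s \<omega>)" "a *\<^sub>R poly_op p A z"]
    by (simp add: A_def norm_minus_commute distrib_right)
qed

section \<open>The Gauss--Newton iteration before stopping\<close>

lemma pair_blinfun:
  fixes B :: "'a::{real_inner,banach} \<Rightarrow>\<^sub>L 'b::{real_inner,banach}"
  shows "adjoint_pair (blinfun_apply B) (adjoint (blinfun_apply B))"
  by (rule adjoint_pair_adjoint) (rule blinfun.bounded_linear_right)

interpretation pair: adjoint_pair "blinfun_apply B" "adjoint (blinfun_apply B)" for B
  by (rule pair_blinfun)

text \<open>
  The constant \<open>K\<close> bounds the error relative to that of the linearised problem.  Its value
  \<open>2r(2 + 4r\<^sup>2)\<close> is what the induction step \<open>step_admissible\<close> produces, with \<open>8r\<^sup>2\<close> being the constant in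
  \<open>noise_controlled\<close>.  Smallness of \<open>L\<parallel>v\<parallel>\<close> is required relative to \<open>K\<^sup>2\<close>, because the Taylor remainder is
  quadratic in the error.
\<close>

locale irgn_problem =
  fixes F :: "'a::{real_inner,banach} \<Rightarrow> 'b::{real_inner,banach}" and F' :: "'a \<Rightarrow> 'a \<Rightarrow>\<^sub>L 'b"
    and xd x0 :: 'a and y v :: 'b and \<alpha> :: "nat \<Rightarrow> real" and \<rho> L r K :: real
  assumes deriv: "\<And>x. x \<in> ball xd \<rho> \<Longrightarrow> (F has_derivative F' x) (at x within ball xd \<rho>)"
    and Fxd: "F xd = y"
    and \<alpha>_pos: "\<And>k. \<alpha> k > 0" and \<alpha>_decr: "\<And>k. \<alpha> (Suc k) \<le> \<alpha> k"
    and \<alpha>_ratio: "\<And>k. \<alpha> k \<le> r * \<alpha> (Suc k)"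
    and \<rho>: "4 * norm (x0 - xd) < \<rho>"
    and Lip: "\<And>x z. x \<in> ball xd \<rho> \<Longrightarrow> z \<in> ball xd \<rho> \<Longrightarrow> norm (F' x - F' z) \<le> L * norm (x - z)"
    and L: "L \<ge> 0"
    and bnd: "norm (F' xd) \<le> sqrt (\<alpha> 0)"
    and source: "x0 - xd = adjoint (F' xd) v"
    and r: "r \<ge> 1" and K: "K = 4 * r + 8 * r ^ 3"
    and small: "100 * K\<^sup>2 * (L * norm v) \<le> 1"
begin

abbreviation T :: "'a \<Rightarrow> 'a \<Rightarrow> 'b" where "T x \<equiv> blinfun_apply (F' x)"
abbreviation Ts :: "'a \<Rightarrow> 'b \<Rightarrow> 'a" where "Ts x \<equiv> adjoint (blinfun_apply (F' x))"
abbreviation R :: "'a \<Rightarrow> real \<Rightarrow> 'a \<Rightarrow> 'a" where "R x \<equiv> adjoint_pair.R (T x) (Ts x)"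
abbreviation N :: "'a \<Rightarrow> real \<Rightarrow> 'b \<Rightarrow> real" where "N x \<equiv> adjoint_pair.res_norm (T x) (Ts x)"
abbreviation e0 :: 'a where "e0 \<equiv> x0 - xd"

definition lam :: real where "lam = L * norm v"
definition lin_error :: "nat \<Rightarrow> 'a" where "lin_error k = \<alpha> k *\<^sub>R R xd (\<alpha> k) e0"
definition lin_norm :: "nat \<Rightarrow> real" where "lin_norm k = norm (lin_error k)"
text \<open>
  The invariant of the iteration.  The first bound keeps the iterate in the ball where the hypotheses
  on \<open>F\<close> hold, the second is the error estimate.
\<close>

definition admissible :: "nat \<Rightarrow> 'a \<Rightarrow> bool" where
  "admissible k x \<longleftrightarrow> norm (x - xd) \<le> 4 * norm e0 \<and> norm (x - xd) \<le> K * lin_norm k"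
definition gn_step :: "'b \<Rightarrow> nat \<Rightarrow> 'a \<Rightarrow> 'a" where
  "gn_step g k x = x - R x (\<alpha> k) (Ts x (F x - g) + \<alpha> k *\<^sub>R (x - x0))"

lemma irgn_Suc: "irgn F F' \<alpha> x0 g (Suc k) = gn_step g k (irgn F F' \<alpha> x0 g k)"
  by (simp add: gn_step_def pair.R_def Let_def)

lemma smallness: "K \<ge> 12" "0 \<le> lam" "lam \<le> 1/1000" "K * lam \<le> 1/1000" "K * K * lam \<le> 1/100"
proof -
  have "r ^ 3 \<ge> 1" using r by (rule one_le_power)
  then show K12: "K \<ge> 12" using r K by linarith
  show lam: "0 \<le> lam" using L by (simp add: lam_def)
  show 1: "K * K * lam \<le> 1/100" using small by (simp add: lam_def power2_eq_square mult_ac)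
  have "12 * (K * lam) \<le> K * (K * lam)" using K12 lam by (intro mult_right_mono mult_nonneg_nonneg) auto
  then show 2: "K * lam \<le> 1/1000" using 1 by simp
  have "12 * lam \<le> K * lam" using K12 lam by (intro mult_right_mono) auto
  then show "lam \<le> 1/1000" using 2 lam by linarith
qed

lemma \<alpha>_mono: "j \<le> k \<Longrightarrow> \<alpha> k \<le> \<alpha> j"
  by (rule lift_Suc_antimono_le[of \<alpha>]) (rule \<alpha>_decr)

lemma sqrt_\<alpha>_ratio: "sqrt (\<alpha> k) \<le> r * sqrt (\<alpha> (Suc k))"
proof -
  have "r \<le> r\<^sup>2" using r by (simp add: power2_eq_square)
  then have "sqrt r \<le> r" using r by (intro real_le_lsqrt) auto
  then show ?thesis
    using \<alpha>_ratio[of k] \<alpha>_pos[of "Suc k"]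
    by (smt (verit) mult_right_mono real_sqrt_le_iff real_sqrt_mult real_sqrt_ge_zero)
qed

lemma lin_norm_nonneg [simp]: "0 \<le> lin_norm k" by (simp add: lin_norm_def)

lemma lin_norm_antimono: "j \<le> k \<Longrightarrow> lin_norm k \<le> lin_norm j"
  unfolding lin_norm_def lin_error_def by (intro pair.scaled_R_mono \<alpha>_pos \<alpha>_mono)

lemma lin_norm_doubling: "lin_norm k \<le> 2 * r * lin_norm (Suc k)"
proof -
  have "lin_norm k \<le> 2 * (\<alpha> k / \<alpha> (Suc k)) * lin_norm (Suc k)"
    unfolding lin_norm_def lin_error_def by (intro pair.scaled_R_doubling \<alpha>_pos \<alpha>_decr)
  also have "\<dots> \<le> 2 * r * lin_norm (Suc k)"
    using \<alpha>_ratio[of k] \<alpha>_pos[of "Suc k"]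
    by (intro mult_right_mono) (auto simp: divide_simps mult.commute)
  finally show ?thesis .
qed

lemma lin_norm_le: "lin_norm k \<le> sqrt (\<alpha> k) * norm v / 2"
proof -
  have "lin_norm k = sqrt (\<alpha> k) * (sqrt (\<alpha> k) * norm (R xd (\<alpha> k) e0))"
    using \<alpha>_pos[of k] by (simp add: lin_norm_def lin_error_def flip: mult.assoc)
  also have "\<dots> \<le> sqrt (\<alpha> k) * (norm v / 2)"
    using pair.norm_R_S[OF \<alpha>_pos, of k "F' xd" v]
    by (intro mult_left_mono) (auto simp: source less_imp_le[OF \<alpha>_pos])
  finally show ?thesis by simp
qed

lemma L_lin_norm_le: "L * lin_norm k \<le> lam * sqrt (\<alpha> k) / 2"
  using mult_left_mono[OF lin_norm_le L, of k] by (simp add: lam_def mult_ac)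

lemma lin_norm_0: "norm e0 \<le> 2 * lin_norm 0"
proof -
  have b: "norm (T xd x) \<le> sqrt (\<alpha> 0) * norm x" for x
    using norm_blinfun[of "F' xd" x] mult_right_mono[OF bnd norm_ge_zero[of x]] by linarith
  have "norm (Ts xd (T xd (R xd (\<alpha> 0) e0))) \<le> sqrt (\<alpha> 0) * norm (T xd (R xd (\<alpha> 0) e0))"
    by (rule pair.norm_S_le[OF b]) (simp add: less_imp_le[OF \<alpha>_pos])
  also have "\<dots> \<le> sqrt (\<alpha> 0) * (sqrt (\<alpha> 0) * norm (R xd (\<alpha> 0) e0))"
    by (intro mult_left_mono b) (simp add: less_imp_le[OF \<alpha>_pos])
  also have "\<dots> = lin_norm 0" using \<alpha>_pos[of 0] by (simp add: lin_norm_def lin_error_def flip: mult.assoc)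
  finally have 1: "norm (Ts xd (T xd (R xd (\<alpha> 0) e0))) \<le> lin_norm 0" .
  have "norm e0 \<le> lin_norm 0 + norm (Ts xd (T xd (R xd (\<alpha> 0) e0)))"
    using pair.R_eqn[OF \<alpha>_pos, of 0 "F' xd" e0] norm_triangle_ineq unfolding lin_norm_def lin_error_def by metis
  with 1 show ?thesis by simp
qed

lemma xd_ball: "xd \<in> ball xd \<rho>"
  using \<rho> norm_ge_zero[of e0] by (simp del: norm_ge_zero)

lemma admissible_ball: "admissible k x \<Longrightarrow> x \<in> ball xd \<rho>"
  using \<rho> by (simp add: admissible_def dist_norm norm_minus_commute)

lemma admissible_0: "admissible 0 x0"
proof -
  have "2 * lin_norm 0 \<le> K * lin_norm 0" using smallness(1) by (intro mult_right_mono) auto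
  then show ?thesis using lin_norm_0 by (simp add: admissible_def)
qed

lemma T_lip: "x \<in> ball xd \<rho> \<Longrightarrow> z \<in> ball xd \<rho> \<Longrightarrow> norm (T x h - T z h) \<le> L * norm (x - z) * norm h"
  using norm_blinfun[of "F' x - F' z" h] mult_right_mono[OF Lip norm_ge_zero[of h], of x z]
  by (simp add: blinfun.diff_left)

lemma Ts_lip: "x \<in> ball xd \<rho> \<Longrightarrow> z \<in> ball xd \<rho> \<Longrightarrow> norm (Ts x h - Ts z h) \<le> L * norm (x - z) * norm h"
  using L by (intro adjoint_pair.norm_S_le[OF adjoint_pair_diff[OF pair_blinfun pair_blinfun]] T_lip) auto

lemma taylor:
  assumes "x \<in> ball xd \<rho>" "z \<in> ball xd \<rho>"
  shows "norm (F x - F z - T z (x - z)) \<le> L * (norm (x - z))\<^sup>2"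
proof -
  have seg: "closed_segment z x \<subseteq> ball xd \<rho>"
    using assms by (simp add: closed_segment_subset)
  have "norm (F x - F z - T z (x - z)) \<le> norm (x - z) * (L * norm (x - z))"
  proof (rule differentiable_bound_linearization[of z x "closed_segment z x" F T z])
    show "z + t *\<^sub>R (x - z) \<in> closed_segment z x" if "t \<in> {0..1}" for t
      using that by (auto simp: closed_segment_def algebra_simps intro!: exI[of _ t])
    show "(F has_derivative T w) (at w within closed_segment z x)" if "w \<in> closed_segment z x" for w
      using deriv seg that by (blast intro: has_derivative_subset)
    show "onorm (T w - T z) \<le> L * norm (x - z)" if w: "w \<in> closed_segment z x" for w
    proof -
      have "onorm (T w - T z) = norm (F' w - F' z)"
        by (simp add: norm_blinfun.rep_eq fun_diff_def minus_blinfun.rep_eq)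
      also have "\<dots> \<le> L * norm (w - z)" using Lip seg w assms by blast
      also have "\<dots> \<le> L * norm (x - z)"
        using segment_bound(1)[OF w] L by (intro mult_left_mono)
      finally show ?thesis .
    qed
  qed auto
  then show ?thesis by (simp add: power2_eq_square mult_ac)
qed

lemma L_err_le:
  assumes "admissible k x" shows "L * norm (x - xd) \<le> K * lam / 2 * sqrt (\<alpha> k)"
proof -
  have "L * norm (x - xd) \<le> K * (L * lin_norm k)"
    using assms mult_left_mono[OF _ L, of "norm (x - xd)" "K * lin_norm k"] by (simp add: admissible_def mult_ac)
  also have "\<dots> \<le> K * (lam * sqrt (\<alpha> k) / 2)"
    using smallness(1) by (intro mult_left_mono L_lin_norm_le) auto
  finally show ?thesis by (simp add: mult_ac)
qed

lemma L_err_sq_le: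
  assumes "admissible k x" shows "L * (norm (x - xd))\<^sup>2 \<le> K * lam / 2 * sqrt (\<alpha> k) * norm (x - xd)"
  using mult_right_mono[OF L_err_le[OF assms] norm_ge_zero[of "x - xd"]]
  by (simp add: power2_eq_square mult_ac)

lemma taylor_xd: "admissible k x \<Longrightarrow> norm (F x - y - T x (x - xd)) \<le> L * (norm (x - xd))\<^sup>2"
  using taylor[OF xd_ball admissible_ball, of k x] Fxd
  by (simp add: norm_minus_commute blinfun.diff_right algebra_simps)

text \<open>
  The error after one step: the regularised initial error for the current derivative, minus the
  contribution of Taylor remainder and noise, which together form the second argument.
\<close>

lemma step_eq:
  "gn_step g k x - xd = \<alpha> k *\<^sub>R R x (\<alpha> k) e0 - R x (\<alpha> k) (Ts x (F x - g - T x (x - xd)))"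
proof -
  define p where "p = F x - g - T x (x - xd)"
  have "Ts x (F x - g) + \<alpha> k *\<^sub>R (x - x0)
      = (\<alpha> k *\<^sub>R (x - xd) + Ts x (T x (x - xd))) + Ts x p - \<alpha> k *\<^sub>R e0"
    by (simp add: p_def pair.S_diff scaleR_diff_right)
  moreover have "R x (\<alpha> k) (\<alpha> k *\<^sub>R (x - xd) + Ts x (T x (x - xd))) = x - xd"
    by (rule pair.R_eqI[OF \<alpha>_pos refl])
  ultimately show ?thesis
    by (simp add: gn_step_def p_def[symmetric] pair.R_add pair.R_diff pair.R_scaleR \<alpha>_pos)
qed

lemma norm_p_le:
  assumes "admissible k x" "norm (g - y) \<le> \<delta>"
  shows "norm (F x - g - T x (x - xd)) \<le> L * (norm (x - xd))\<^sup>2 + \<delta>"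
  using norm_triangle_ineq4[of "F x - y - T x (x - xd)" "g - y"] taylor_xd[OF assms(1)] assms(2)
  by (simp add: algebra_simps)

lemma lin_perturb:
  assumes "x \<in> ball xd \<rho>" "a > 0"
  shows "norm (a *\<^sub>R R x a e0 - a *\<^sub>R R xd a e0) \<le> 5/4 * lam * norm (x - xd)"
  using scaled_resolvent_perturbation[OF pair_blinfun pair_blinfun assms(2) T_lip[OF assms(1) xd_ball], of v] L
  by (simp add: source lam_def mult_ac)

lemma noise_term:
  assumes "admissible k x" "norm (g - y) \<le> \<delta>"
  shows "norm (R x (\<alpha> k) (Ts x (F x - g - T x (x - xd)))) \<le> K * lam / 4 * norm (x - xd) + \<delta> / (2 * sqrt (\<alpha> k))"
proof -
  have "2 * sqrt (\<alpha> k) * norm (R x (\<alpha> k) (Ts x (F x - g - T x (x - xd))))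
      \<le> K * lam / 2 * sqrt (\<alpha> k) * norm (x - xd) + \<delta>"
    using pair.norm_R_S[OF \<alpha>_pos, of k "F' x" "F x - g - T x (x - xd)"] norm_p_le[OF assms]
      L_err_sq_le[OF assms(1)] by linarith
  then show ?thesis using \<alpha>_pos[of k] by (simp add: field_simps)
qed

lemma step_error:
  assumes "admissible k x" "norm (g - y) \<le> \<delta>"
  shows "norm (gn_step g k x - xd - lin_error k) \<le> 2 * K * lam * norm (x - xd) + \<delta> / (2 * sqrt (\<alpha> k))"
    and "norm (gn_step g k x - xd) \<le> norm e0 + 2 * K * lam * norm (x - xd) + \<delta> / (2 * sqrt (\<alpha> k))"
proof -
  let ?n = "norm (x - xd)"
  have k: "(5/4 + K/4) * lam * ?n \<le> (2 * K) * lam * ?n" 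
    using smallness(1,2) by (intro mult_right_mono) auto
  have k': "0 \<le> lam * ?n" using smallness(2) by simp
  show "norm (gn_step g k x - xd - lin_error k) \<le> 2 * K * lam * ?n + \<delta> / (2 * sqrt (\<alpha> k))"
    using norm_triangle_ineq4[of "\<alpha> k *\<^sub>R R x (\<alpha> k) e0 - lin_error k" "R x (\<alpha> k) (Ts x (F x - g - T x (x - xd)))"]
      noise_term[OF assms] lin_perturb[OF admissible_ball[OF assms(1)] \<alpha>_pos, of k] k
    by (simp add: step_eq lin_error_def algebra_simps)
  show "norm (gn_step g k x - xd) \<le> norm e0 + 2 * K * lam * ?n + \<delta> / (2 * sqrt (\<alpha> k))"
    using norm_triangle_ineq4[of "\<alpha> k *\<^sub>R R x (\<alpha> k) e0" "R x (\<alpha> k) (Ts x (F x - g - T x (x - xd)))"]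
      noise_term[OF assms] pair.norm_R[OF \<alpha>_pos, of k "F' x" e0] k k' \<alpha>_pos[of k]
    by (simp add: step_eq algebra_simps)
qed

text \<open>
  What the failure of the stopping rule says about the noise level.  The first bound has a constant
  close to one and keeps the next iterate in the ball; the second one, with a larger constant,
  preserves the error estimate.  Both hold trivially for \<open>\<delta> = 0\<close>.
\<close>

definition noise_controlled :: "real \<Rightarrow> nat \<Rightarrow> 'a \<Rightarrow> bool" where
  "noise_controlled \<delta> k x \<longleftrightarrow> \<delta> \<le> (1 + 2 * K * lam) * sqrt (\<alpha> k) * norm (x - xd)
     \<and> \<delta> \<le> 8 * r\<^sup>2 * sqrt (\<alpha> k) * lin_norm k"

lemma step_admissible:
  assumes I: "admissible k x" and n: "norm (g - y) \<le> \<delta>" and c: "noise_controlled \<delta> k x"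
  shows "admissible (Suc k) (gn_step g k x)"
proof -
  let ?n = "norm (x - xd)"
  have s: "sqrt (\<alpha> k) > 0" using \<alpha>_pos by simp
  have 1: "\<delta> / (2 * sqrt (\<alpha> k)) \<le> (1 + 2 * K * lam) / 2 * ?n"
    using c s by (simp add: noise_controlled_def field_simps)
  have 2: "\<delta> / (2 * sqrt (\<alpha> k)) \<le> 4 * r\<^sup>2 * lin_norm k"
    using c s by (simp add: noise_controlled_def field_simps)
  have kl: "(3 * (K * lam)) * ?n \<le> (1/4) * ?n" using smallness by (intro mult_right_mono) auto
  have "norm (gn_step g k x - xd) \<le> norm e0 + 3/4 * ?n"
    using step_error(2)[OF I n] 1 kl by (simp add: algebra_simps)
  then have A: "norm (gn_step g k x - xd) \<le> 4 * norm e0" using I by (simp add: admissible_def)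
  have "2 * K * lam * ?n \<le> 2 * K * lam * (K * lin_norm k)"
    using I smallness by (intro mult_left_mono) (auto simp: admissible_def)
  also have "\<dots> = (2 * (K * K * lam)) * lin_norm k" by simp
  also have "\<dots> \<le> 1 * lin_norm k" using smallness(5) by (intro mult_right_mono) auto
  finally have 3: "2 * K * lam * ?n \<le> lin_norm k" by simp
  have "norm (gn_step g k x - xd) \<le> norm (gn_step g k x - xd - lin_error k) + lin_norm k"
    using norm_triangle_ineq[of "gn_step g k x - xd - lin_error k" "lin_error k"] by (simp add: lin_norm_def)
  also have "\<dots> \<le> (2 + 4 * r\<^sup>2) * lin_norm k"
    using step_error(1)[OF I n] 2 3 by (simp add: algebra_simps)
  also have "\<dots> \<le> (2 + 4 * r\<^sup>2) * (2 * r * lin_norm (Suc k))"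
    by (intro mult_left_mono lin_norm_doubling) auto
  also have "\<dots> = K * lin_norm (Suc k)" by (simp add: K algebra_simps power2_eq_square power3_eq_cube)
  finally show ?thesis using A by (simp add: admissible_def)
qed

lemma residual_weighted_le:
  assumes "admissible k x" "norm (g - y) \<le> \<delta>"
  shows "N x (\<alpha> k) (F x - g) \<le> (1 + K * lam / 2) * sqrt (\<alpha> k) * norm (x - xd) + \<delta>"
proof -
  define p where "p = F x - g - T x (x - xd)"
  have "N x (\<alpha> k) (F x - g) = N x (\<alpha> k) (T x (x - xd) + p)" by (simp add: p_def)
  also have "\<dots> \<le> N x (\<alpha> k) (T x (x - xd)) + N x (\<alpha> k) p" by (rule pair.res_norm_triangle[OF \<alpha>_pos])
  also have "\<dots> \<le> sqrt (\<alpha> k) * norm (x - xd) + norm p"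
    by (intro add_mono pair.res_norm_T pair.res_norm_le_norm \<alpha>_pos)
  also have "\<dots> \<le> (1 + K * lam / 2) * sqrt (\<alpha> k) * norm (x - xd) + \<delta>"
    using norm_p_le[OF assms] L_err_sq_le[OF assms(1)] by (simp add: p_def algebra_simps)
  finally show ?thesis .
qed

text \<open>
  The weighted norm turns \<open>T\<^sub>k e\<^sub>k\<close> into \<open>\<surd>\<alpha>\<^sub>k \<parallel>e\<^sub>k\<parallel>\<close> and the noise contributes \<open>\<delta>\<close>; a residual
  above \<open>2\<delta>\<close> leaves \<open>\<delta>\<close> on the other side.
\<close>

lemma unstopped_error_bound:
  assumes I: "admissible k x" and n: "norm (g - y) \<le> \<delta>" and u: "2 * \<delta> < N x (\<alpha> k) (F x - g)"
  shows "\<delta> \<le> (1 + 2 * K * lam) * sqrt (\<alpha> k) * norm (x - xd)"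
proof -
  have "\<delta> \<le> (1 + K * lam / 2) * (sqrt (\<alpha> k) * norm (x - xd))"
    using residual_weighted_le[OF I n] u by (simp add: mult.assoc)
  also have "\<dots> \<le> (1 + 2 * K * lam) * (sqrt (\<alpha> k) * norm (x - xd))"
    using smallness \<alpha>_pos[of k] by (intro mult_right_mono) auto
  finally show ?thesis by (simp add: mult.assoc)
qed

lemma unstopped_start_controlled:
  assumes n: "norm (g - y) \<le> \<delta>" and u: "2 * \<delta> < N x0 (\<alpha> 0) (F x0 - g)"
  shows "noise_controlled \<delta> 0 x0"
proof -
  have 1: "\<delta> \<le> (1 + 2 * K * lam) * sqrt (\<alpha> 0) * norm e0"
    by (rule unstopped_error_bound[OF admissible_0 n u])
  also have "\<dots> \<le> 2 * sqrt (\<alpha> 0) * (2 * lin_norm 0)"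
    using smallness \<alpha>_pos[of 0] lin_norm_0 by (intro mult_mono) auto
  also have "\<dots> \<le> (8 * r\<^sup>2) * (sqrt (\<alpha> 0) * lin_norm 0)"
  proof -
    have "1 \<le> r\<^sup>2" using r by (rule one_le_power)
    then have "4 * (sqrt (\<alpha> 0) * lin_norm 0) \<le> (8 * r\<^sup>2) * (sqrt (\<alpha> 0) * lin_norm 0)"
      using \<alpha>_pos[of 0] by (intro mult_right_mono) auto
    then show ?thesis by (simp add: mult_ac)
  qed
  finally show ?thesis using 1 by (simp add: noise_controlled_def mult.assoc)
qed

definition lin_residual :: "'b \<Rightarrow> nat \<Rightarrow> 'a \<Rightarrow> 'b" where
  "lin_residual g k x = F x - g + T x (gn_step g k x - x)"

lemma lin_residual_eq:
  fixes g k x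
  defines "p \<equiv> F x - g - T x (x - xd)"
  shows "lin_residual g k x = T x (\<alpha> k *\<^sub>R R x (\<alpha> k) e0) + (p - T x (R x (\<alpha> k) (Ts x p)))"
proof -
  have "lin_residual g k x = p + T x (gn_step g k x - xd)"
    by (simp add: lin_residual_def p_def blinfun.diff_right)
  then show ?thesis
    unfolding step_eq p_def[symmetric] by (simp add: blinfun.diff_right)
qed

text \<open>
  The normal equation of the linearised problem.  It places \<open>x\<^sub>k\<^sub>+\<^sub>1 - x\<^sub>0\<close> in the range of \<open>T\<^sub>k\<^sup>*\<close> with a
  preimage that is nearly the residual of the new iterate.
\<close>

lemma step_optimality: "\<alpha> k *\<^sub>R (gn_step g k x - x0) = - Ts x (lin_residual g k x)"
proof -
  define u where "u = Ts x (F x - g)"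
  define d where "d = \<alpha> k *\<^sub>R (x - x0)"
  define w where "w = R x (\<alpha> k) (u + d)"
  have st: "gn_step g k x - x = - w" by (simp add: gn_step_def w_def u_def d_def)
  have "\<alpha> k *\<^sub>R w + Ts x (T x w) = u + d"
    unfolding w_def by (rule pair.R_eqn[OF \<alpha>_pos])
  then have "Ts x (T x w) = u + d - \<alpha> k *\<^sub>R w" by (metis add_diff_cancel_left')
  moreover have "Ts x (lin_residual g k x) = u - Ts x (T x w)"
    unfolding lin_residual_def st blinfun.minus_right u_def pair.S_diff[symmetric] by simp
  moreover have "\<alpha> k *\<^sub>R (gn_step g k x - x0) = d - \<alpha> k *\<^sub>R w"
  proof -
    have "gn_step g k x - x0 = (x - x0) - w" using st by (simp add: algebra_simps)
    then show ?thesis by (simp only: d_def scaleR_diff_right)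
  qed
  ultimately show ?thesis by simp
qed

lemma lin_residual_taylor:
  assumes "admissible k x" "admissible (Suc k) (gn_step g k x)"
  shows "norm (F (gn_step g k x) - g - lin_residual g k x) \<le> L * (norm (gn_step g k x - x))\<^sup>2"
  using taylor[OF admissible_ball[OF assms(2)] admissible_ball[OF assms(1)]]
  by (simp add: lin_residual_def algebra_simps)

lemma step_length:
  assumes "admissible k x" "admissible (Suc k) (gn_step g k x)"
  shows "norm (gn_step g k x - x) \<le> 2 * K * lin_norm k"
proof -
  have "norm (gn_step g k x - x) \<le> norm (gn_step g k x - xd) + norm (x - xd)"
    using norm_triangle_ineq4[of "gn_step g k x - xd" "x - xd"] by simp
  also have "\<dots> \<le> K * lin_norm (Suc k) + K * lin_norm k" using assms by (auto simp: admissible_def)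
  also have "\<dots> \<le> K * lin_norm k + K * lin_norm k"
    using smallness(1) lin_norm_antimono[of k "Suc k"] by (intro add_right_mono mult_left_mono) auto
  finally show ?thesis by simp
qed

lemma L_step_length:
  assumes "admissible k x" "admissible (Suc k) (gn_step g k x)"
  shows "L * norm (gn_step g k x - x) \<le> K * lam * sqrt (\<alpha> k)"
proof -
  have "L * norm (gn_step g k x - x) \<le> 2 * K * (L * lin_norm k)"
    using mult_left_mono[OF step_length[OF assms] L] by (simp add: mult_ac)
  also have "\<dots> \<le> 2 * K * (lam * sqrt (\<alpha> k) / 2)"
    using smallness(1) by (intro mult_left_mono L_lin_norm_le) auto
  finally show ?thesis by (simp add: mult_ac)
qed

text \<open>
  The residual of the new iterate is \<open>T\<^sub>k s\<close> with \<open>s = \<alpha>\<^sub>k(\<alpha>\<^sub>k + A\<^sub>k)\<^sup>-\<^sup>1 e\<^sub>0\<close>, plus a contraction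
  applied to noise and Taylor remainder, plus quadratic terms.  After replacing \<open>T\<^sub>k\<close> by \<open>T\<^sub>k\<^sub>+\<^sub>1\<close> the
  weighted norm of the main term is at most \<open>\<surd>\<alpha>\<^sub>k\<^sub>+\<^sub>1 \<parallel>s\<parallel>\<close>.  The bound involves \<open>\<parallel>lin\<^sub>k\<parallel>\<close> instead of
  \<open>\<parallel>e\<^sub>k\<^sub>+\<^sub>1\<parallel>\<close>; with the latter, the constants of the induction would grow from step to step when \<open>r\<close> is
  large.
\<close>

lemma unstopped_controlled:
  assumes I: "admissible k x" and n: "norm (g - y) \<le> \<delta>" and I': "admissible (Suc k) (gn_step g k x)"
    and u: "2 * \<delta> < N (gn_step g k x) (\<alpha> (Suc k)) (F (gn_step g k x) - g)"
  shows "noise_controlled \<delta> (Suc k) (gn_step g k x)"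
proof -
  define x' where "x' = gn_step g k x"
  define s where "s = \<alpha> k *\<^sub>R R x (\<alpha> k) e0"
  define p where "p = F x - g - T x (x - xd)"
  define q where "q = p - T x (R x (\<alpha> k) (Ts x p))"
  define h where "h = F x' - g - lin_residual g k x"
  let ?N = "N x' (\<alpha> (Suc k))"
  let ?M = "sqrt (\<alpha> k) * lin_norm k"
  have M: "0 \<le> ?M" using \<alpha>_pos[of k] by simp
  have sq: "sqrt (\<alpha> (Suc k)) \<le> sqrt (\<alpha> k)" using \<alpha>_decr by simp
  have e: "norm (x - xd) \<le> K * lin_norm k" using I by (simp add: admissible_def)
  have "norm s \<le> lin_norm k + 5/4 * lam * norm (x - xd)"
    using lin_perturb[OF admissible_ball[OF I] \<alpha>_pos, of k] norm_triangle_sub[of s "lin_error k"]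
    by (simp add: s_def lin_error_def lin_norm_def)
  also have "\<dots> \<le> lin_norm k + 5/4 * lam * (K * lin_norm k)"
    using e smallness(2) by (intro add_left_mono mult_left_mono) auto
  also have "\<dots> = (1 + 5/4 * (K * lam)) * lin_norm k" by (simp add: algebra_simps)
  also have "\<dots> \<le> 2 * lin_norm k" using smallness by (intro mult_right_mono) auto
  finally have s: "norm s \<le> 2 * lin_norm k" .
  have dec: "F x' - g = T x' s + ((T x s - T x' s) + (q + h))"
    using lin_residual_eq[of g k x] by (simp add: h_def q_def p_def s_def)
  have "?N (F x' - g) \<le> ?N (T x' s) + ?N ((T x s - T x' s) + (q + h))"
    unfolding dec by (rule pair.res_norm_triangle[OF \<alpha>_pos])
  also have "\<dots> \<le> sqrt (\<alpha> (Suc k)) * norm s + norm ((T x s - T x' s) + (q + h))"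
    by (intro add_mono pair.res_norm_T pair.res_norm_le_norm \<alpha>_pos)
  also have "\<dots> \<le> sqrt (\<alpha> (Suc k)) * norm s + norm (T x s - T x' s) + norm q + norm h"
    using norm_triangle_ineq[of "T x s - T x' s" "q + h"] norm_triangle_ineq[of q h] by simp
  finally have tri: "?N (F x' - g) \<le> sqrt (\<alpha> (Suc k)) * norm s + norm (T x s - T x' s) + norm q + norm h" .
  have t1: "sqrt (\<alpha> (Suc k)) * norm s \<le> 2 * ?M"
    using mult_mono[OF sq s] \<alpha>_pos[of k] by simp
  have Ld: "L * norm (x' - x) \<le> K * lam * sqrt (\<alpha> k)"
    unfolding x'_def by (rule L_step_length[OF I I'])
  have t2: "norm (T x s - T x' s) \<le> 2 * (K * lam) * ?M"
  proof -
    have "norm (T x s - T x' s) \<le> L * norm (x' - x) * norm s"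
      using T_lip[OF admissible_ball[OF I] admissible_ball[OF I'], of s] by (simp add: x'_def norm_minus_commute)
    also have "\<dots> \<le> K * lam * sqrt (\<alpha> k) * (2 * lin_norm k)"
      by (rule mult_mono[OF Ld s]) (use smallness \<alpha>_pos[of k] in auto)
    finally show ?thesis by simp
  qed
  have t3: "norm q \<le> K * K * lam / 2 * ?M + \<delta>"
  proof -
    have "norm q \<le> norm p" unfolding q_def by (rule pair.norm_diff_T_R_S[OF \<alpha>_pos])
    also have "\<dots> \<le> K * lam / 2 * sqrt (\<alpha> k) * norm (x - xd) + \<delta>"
      using norm_p_le[OF I n] L_err_sq_le[OF I] by (simp add: p_def)
    also have "\<dots> \<le> K * lam / 2 * sqrt (\<alpha> k) * (K * lin_norm k) + \<delta>"
      using e smallness \<alpha>_pos[of k] by (intro add_right_mono mult_left_mono mult_nonneg_nonneg) auto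
    finally show ?thesis by (simp add: mult_ac)
  qed
  have t4: "norm h \<le> 2 * (K * K * lam) * ?M"
  proof -
    have "norm h \<le> (L * norm (x' - x)) * norm (x' - x)"
      using lin_residual_taylor[OF I I'] by (simp add: h_def x'_def power2_eq_square mult_ac)
    also have "\<dots> \<le> (K * lam * sqrt (\<alpha> k)) * (2 * K * lin_norm k)"
      using step_length[OF I I'] smallness \<alpha>_pos[of k]
      by (intro mult_mono[OF Ld]) (auto simp: x'_def)
    finally show ?thesis by (simp add: mult_ac)
  qed
  have "\<delta> \<le> 2 * ?M + 2 * (K * lam) * ?M + K * K * lam / 2 * ?M + 2 * (K * K * lam) * ?M"
    using tri t1 t2 t3 t4 u[folded x'_def] by linarith
  also have "\<dots> = (2 + 2 * (K * lam) + 5/2 * (K * K * lam)) * ?M" by (simp add: algebra_simps)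
  also have "\<dots> \<le> 4 * ?M" using smallness M by (intro mult_right_mono) auto
  also have "\<dots> \<le> 4 * ((r * sqrt (\<alpha> (Suc k))) * (2 * r * lin_norm (Suc k)))"
    using sqrt_\<alpha>_ratio[of k] lin_norm_doubling[of k] r \<alpha>_pos[of "Suc k"]
    by (intro mult_left_mono mult_mono) auto
  finally have "\<delta> \<le> 8 * r\<^sup>2 * sqrt (\<alpha> (Suc k)) * lin_norm (Suc k)"
    by (simp add: power2_eq_square mult_ac)
  then show ?thesis
    using unstopped_error_bound[OF I' n u] by (simp add: noise_controlled_def)
qed

lemma noise_free_admissible: "admissible k (irgn F F' \<alpha> x0 y k)"
proof (induction k)
  case 0 then show ?case by (simp add: admissible_0)
next
  case (Suc k)
  have "noise_controlled 0 k (irgn F F' \<alpha> x0 y k)"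
    using smallness r \<alpha>_pos[of k] by (auto simp: noise_controlled_def)
  then show ?case unfolding irgn_Suc by (intro step_admissible[OF Suc, where \<delta> = 0]) auto
qed

text \<open>
  In the step formula the deviation from \<open>lin\<^sub>k\<close> is a small multiple of \<open>\<parallel>e\<^sub>k\<parallel> \<le> K\<parallel>lin\<^sub>k\<parallel>\<close>, so it cannot
  cancel more than half of \<open>lin\<^sub>k\<close>.
\<close>

lemma noise_free_lower: "lin_norm k \<le> 2 * norm (irgn F F' \<alpha> x0 y k - xd)"
proof (cases k)
  case 0
  then show ?thesis
    using pair.norm_R[OF \<alpha>_pos, of 0 "F' xd" e0] \<alpha>_pos[of 0] norm_ge_zero[of e0]
    by (simp add: lin_norm_def lin_error_def del: norm_ge_zero)
next
  case (Suc j)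
  let ?x = "irgn F F' \<alpha> x0 y j"
  have "2 * K * lam * norm (?x - xd) \<le> 2 * K * lam * (K * lin_norm j)"
    using noise_free_admissible[of j] smallness by (intro mult_left_mono) (auto simp: admissible_def)
  also have "\<dots> = (2 * (K * K * lam)) * lin_norm j" by simp
  also have "\<dots> \<le> 1/2 * lin_norm j" using smallness by (intro mult_right_mono) auto
  finally have "norm (gn_step y j ?x - xd - lin_error j) \<le> lin_norm j / 2"
    using step_error(1)[OF noise_free_admissible, of y 0 j] by simp
  then have "lin_norm j \<le> 2 * norm (gn_step y j ?x - xd)"
    using norm_triangle_ineq2[of "lin_error j" "gn_step y j ?x - xd"] by (simp add: lin_norm_def norm_minus_commute)
  then show ?thesis using Suc lin_norm_antimono[of j k] irgn_Suc[of y j] by simp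
qed

lemma stop_rule_iff:
  assumes "\<tau> \<ge> 0" "\<delta> \<ge> 0"
  shows "stop_rule F F' \<alpha> x0 g \<tau> \<delta> k \<longleftrightarrow>
    N (irgn F F' \<alpha> x0 g k) (\<alpha> k) (F (irgn F F' \<alpha> x0 g k) - g) \<le> \<tau> * \<delta>"
proof -
  let ?x = "irgn F F' \<alpha> x0 g k"
  have "stop_rule F F' \<alpha> x0 g \<tau> \<delta> k \<longleftrightarrow> (N ?x (\<alpha> k) (F ?x - g))\<^sup>2 \<le> (\<tau> * \<delta>)\<^sup>2"
    by (simp add: stop_rule_def Let_def pair.res_norm_sq[OF \<alpha>_pos] power_mult_distrib)
  also have "\<dots> \<longleftrightarrow> N ?x (\<alpha> k) (F ?x - g) \<le> \<tau> * \<delta>"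
    using assms by (simp add: power2_le_iff_abs_le pair.res_norm_nonneg abs_of_nonneg)
  finally show ?thesis .
qed

end

locale irgn_noisy = irgn_problem +
  fixes g :: 'b and \<tau> \<delta> :: real
  assumes noise: "norm (g - y) \<le> \<delta>" and \<delta>: "\<delta> > 0" and \<tau>: "\<tau> > 2"
begin

abbreviation iter :: "nat \<Rightarrow> 'a" where "iter \<equiv> irgn F F' \<alpha> x0 g"
abbreviation stop :: "nat \<Rightarrow> bool" where "stop \<equiv> stop_rule F F' \<alpha> x0 g \<tau> \<delta>"

lemma stop_iff: "stop k \<longleftrightarrow> N (iter k) (\<alpha> k) (F (iter k) - g) \<le> \<tau> * \<delta>"
  using \<tau> \<delta> by (intro stop_rule_iff) auto

lemma unstopped: "\<not> stop k \<Longrightarrow> 2 * \<delta> < N (iter k) (\<alpha> k) (F (iter k) - g)"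
proof -
  have "2 * \<delta> < \<tau> * \<delta>" using \<tau> \<delta> by simp
  then show "\<not> stop k \<Longrightarrow> 2 * \<delta> < N (iter k) (\<alpha> k) (F (iter k) - g)" by (simp add: stop_iff)
qed

text \<open>
  While the rule has not fired, the noise is controlled, and this is the hypothesis under which the
  invariant passes to the next iterate; both are therefore carried along the same induction.
\<close>

lemma before_stop:
  assumes "\<And>j. j < k \<Longrightarrow> \<not> stop j"
  shows "admissible k (iter k) \<and> (\<not> stop k \<longrightarrow> noise_controlled \<delta> k (iter k))"
  using assms
proof (induction k)
  case 0
  then show ?case using admissible_0 unstopped_start_controlled[OF noise] unstopped[of 0] by simp
next
  case (Suc k)
  have I: "admissible k (iter k)" and c: "noise_controlled \<delta> k (iter k)"
    using Suc.IH Suc.prems by auto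
  have I': "admissible (Suc k) (gn_step g k (iter k))" by (rule step_admissible[OF I noise c])
  show ?case
    using I' unstopped_controlled[OF I noise I'] unstopped[of "Suc k"] unfolding irgn_Suc by blast
qed

text \<open>
  Otherwise \<open>\<delta>\<close> would be bounded by a multiple of \<open>\<surd>\<alpha>\<^sub>k \<parallel>lin\<^sub>k\<parallel> \<le> \<alpha>\<^sub>k \<parallel>v\<parallel>/2\<close> for all \<open>k\<close>.
\<close>

lemma stops:
  assumes "\<alpha> \<longlonglongrightarrow> 0" shows "\<exists>k. stop k"
proof (rule ccontr)
  assume "\<nexists>k. stop k"
  then have c: "noise_controlled \<delta> k (iter k)" for k using before_stop by blast
  have "\<delta> \<le> (4 * r\<^sup>2 * norm v) * \<alpha> k" for k
  proof -
    have "\<delta> \<le> 8 * r\<^sup>2 * sqrt (\<alpha> k) * lin_norm k" using c by (simp add: noise_controlled_def)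
    also have "\<dots> \<le> 8 * r\<^sup>2 * sqrt (\<alpha> k) * (sqrt (\<alpha> k) * norm v / 2)"
      using \<alpha>_pos[of k] by (intro mult_left_mono lin_norm_le) auto
    also have "\<dots> = (4 * r\<^sup>2 * norm v) * (sqrt (\<alpha> k) * sqrt (\<alpha> k))" by (simp add: mult_ac)
    finally show ?thesis using \<alpha>_pos[of k] by simp
  qed
  moreover have "(\<lambda>k. (4 * r\<^sup>2 * norm v) * \<alpha> k) \<longlonglongrightarrow> (4 * r\<^sup>2 * norm v) * 0"
    by (intro tendsto_intros assms)
  ultimately have "\<delta> \<le> (4 * r\<^sup>2 * norm v) * 0"
    by (intro LIMSEQ_le_const) auto
  then show False using \<delta> by simp
qed

end

section \<open>The error of the stopped iterate\<close>

context irgn_problem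
begin

text \<open>
  The source condition makes \<open>T\<^sub>k \<alpha>\<^sub>k(\<alpha>\<^sub>k + A\<^sub>k)\<^sup>-\<^sup>1 e\<^sub>0\<close> of order \<open>\<alpha>\<^sub>k\<parallel>v\<parallel>\<close>, and the noise is of the same
  order as long as it is controlled.
\<close>

lemma lin_residual_le:
  assumes I: "admissible k x" and n: "norm (g - y) \<le> \<delta>" and c: "noise_controlled \<delta> k x"
  shows "norm (lin_residual g k x) \<le> K * \<alpha> k * norm v"
proof -
  define p where "p = F x - g - T x (x - xd)"
  let ?a = "\<alpha> k" and ?n = "norm (x - xd)"
  have a: "?a > 0" "sqrt ?a * sqrt ?a = ?a" using \<alpha>_pos[of k] by auto
  have e: "?n \<le> K * lin_norm k" using I by (simp add: admissible_def)
  have e0: "e0 = Ts x v + (Ts xd v - Ts x v)" by (simp add: source)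
  have "T x (?a *\<^sub>R R x ?a e0) = ?a *\<^sub>R T x (R x ?a (Ts x v)) + ?a *\<^sub>R T x (R x ?a (Ts xd v - Ts x v))"
    by (subst e0) (simp only: pair.R_add[OF a(1)] blinfun.add_right blinfun.scaleR_right scaleR_add_right)
  then have "norm (T x (?a *\<^sub>R R x ?a e0))
      \<le> ?a * norm (T x (R x ?a (Ts x v))) + ?a * norm (T x (R x ?a (Ts xd v - Ts x v)))"
    using norm_triangle_ineq a by (metis abs_of_pos norm_scaleR)
  also have "\<dots> \<le> ?a * norm v + (sqrt ?a / 2) * (2 * sqrt ?a * norm (T x (R x ?a (Ts xd v - Ts x v))))"
    using pair.norm_T_R_S[OF a(1), of "F' x" v] a by (simp add: mult_left_mono flip: mult.assoc)
  also have "\<dots> \<le> ?a * norm v + (sqrt ?a / 2) * (L * ?n * norm v)"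
    using pair.norm_T_R[OF a(1), of "F' x" "Ts xd v - Ts x v"] Ts_lip[OF admissible_ball[OF I] xd_ball, of v] a(1)
    by (intro add_left_mono mult_left_mono) (auto simp: norm_minus_commute)
  also have "\<dots> \<le> ?a * norm v + (sqrt ?a / 2) * (K * lam / 2 * sqrt ?a * norm v)"
    using L_err_le[OF I] a(1) by (intro add_left_mono mult_left_mono mult_right_mono) auto
  also have "\<dots> = (1 + K * lam / 4) * (?a * norm v)" using a(2) by (simp add: algebra_simps)
  finally have 1: "norm (T x (?a *\<^sub>R R x ?a e0)) \<le> (1 + K * lam / 4) * (?a * norm v)" .
  have rnv: "sqrt ?a * lin_norm k \<le> ?a * norm v / 2"
    using mult_left_mono[OF lin_norm_le, of "sqrt ?a" k] a by (simp flip: mult.assoc)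
  have "norm (p - T x (R x ?a (Ts x p))) \<le> norm p" by (rule pair.norm_diff_T_R_S[OF a(1)])
  also have "\<dots> \<le> K * lam / 2 * sqrt ?a * ?n + \<delta>"
    using norm_p_le[OF I n] L_err_sq_le[OF I] by (simp add: p_def)
  also have "\<dots> \<le> K * lam / 2 * sqrt ?a * (K * lin_norm k) + 8 * r\<^sup>2 * sqrt ?a * lin_norm k"
    using e smallness a c by (intro add_mono mult_left_mono mult_nonneg_nonneg) (auto simp: noise_controlled_def)
  also have "\<dots> = (K * K * lam / 2 + 8 * r\<^sup>2) * (sqrt ?a * lin_norm k)" by (simp add: algebra_simps)
  also have "\<dots> \<le> (K * K * lam / 2 + 8 * r\<^sup>2) * (?a * norm v / 2)"
    using smallness by (intro mult_left_mono rnv) auto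
  finally have 2: "norm (p - T x (R x ?a (Ts x p))) \<le> (K * K * lam / 4 + 4 * r\<^sup>2) * (?a * norm v)"
    by (simp add: algebra_simps)
  have "r\<^sup>2 \<le> r ^ 3" using r by (intro power_increasing) auto
  then have "(1 + K * lam / 4) + (K * K * lam / 4 + 4 * r\<^sup>2) \<le> K" using K r smallness by simp
  then have "((1 + K * lam / 4) + (K * K * lam / 4 + 4 * r\<^sup>2)) * (?a * norm v) \<le> K * (?a * norm v)"
    using a by (intro mult_right_mono) auto
  then show ?thesis
    using norm_triangle_ineq[of "T x (?a *\<^sub>R R x ?a e0)" "p - T x (R x ?a (Ts x p))"] 1 2
    unfolding lin_residual_eq p_def[symmetric] by (simp add: algebra_simps)
qed

text \<open>
  The old error is controlled by the new one, since \<open>\<parallel>e\<^sub>k\<parallel> \<le> K\<parallel>lin\<^sub>k\<parallel>\<close> and \<open>lin\<^sub>k\<close> is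
  close to \<open>e\<^sub>k\<^sub>+\<^sub>1\<close>.
\<close>

lemma step_length_le_error:
  assumes I: "admissible k x" and n: "norm (g - y) \<le> \<delta>" and I': "admissible (Suc k) (gn_step g k x)" and "\<delta> \<ge> 0"
  shows "norm (gn_step g k x - x) \<le> 3 * K * norm (gn_step g k x - xd) + K * (\<delta> / sqrt (\<alpha> (Suc k)))"
proof -
  let ?e' = "norm (gn_step g k x - xd)"
  have "2 * K * lam * norm (x - xd) \<le> 2 * K * lam * (K * lin_norm k)"
    using I smallness by (intro mult_left_mono) (auto simp: admissible_def)
  also have "\<dots> = (2 * (K * K * lam)) * lin_norm k" by simp
  also have "\<dots> \<le> 1/2 * lin_norm k" using smallness by (intro mult_right_mono) auto
  finally have "norm (gn_step g k x - xd - lin_error k) \<le> lin_norm k / 2 + \<delta> / (2 * sqrt (\<alpha> k))"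
    using step_error(1)[OF I n] by simp
  then have "lin_norm k \<le> 2 * ?e' + \<delta> / sqrt (\<alpha> k)"
    using norm_triangle_ineq2[of "lin_error k" "gn_step g k x - xd"] by (simp add: lin_norm_def norm_minus_commute)
  also have "\<dots> \<le> 2 * ?e' + \<delta> / sqrt (\<alpha> (Suc k))"
    using \<alpha>_decr[of k] \<alpha>_pos assms(4) by (intro add_left_mono divide_left_mono) auto
  finally have "K * lin_norm k \<le> K * (2 * ?e' + \<delta> / sqrt (\<alpha> (Suc k)))"
    using smallness(1) by (intro mult_left_mono) auto
  then have "norm (x - xd) \<le> K * (2 * ?e' + \<delta> / sqrt (\<alpha> (Suc k)))"
    using I unfolding admissible_def by linarith
  moreover have "?e' \<le> K * ?e'" using smallness(1) mult_right_mono[of 1 K ?e'] by simp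
  moreover have "norm (gn_step g k x - x) \<le> ?e' + norm (x - xd)"
    using norm_triangle_ineq4[of "gn_step g k x - xd" "x - xd"] by simp
  ultimately show ?thesis by (simp add: algebra_simps)
qed

text \<open>
  An approximate optimality condition that refers only to the derivative at \<open>x\<close> and to the residual
  appearing in the stopping rule.  It holds with every parameter \<open>\<beta> \<le> \<alpha>\<^sub>l\<close>, since dividing the exact
  condition by \<open>\<alpha>\<^sub>l\<^sub>-\<^sub>1\<close> and multiplying by \<open>\<beta>\<close> gives \<open>\<theta> = \<beta>/\<alpha>\<^sub>l\<^sub>-\<^sub>1 \<le> 1\<close>; for the initial guess,
  \<open>\<theta> = 0\<close>.
\<close>

definition residual_representable :: "'b \<Rightarrow> real \<Rightarrow> nat \<Rightarrow> 'a \<Rightarrow> bool" where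
  "residual_representable g \<delta> l x \<longleftrightarrow> (\<forall>\<beta>. 0 < \<beta> \<and> \<beta> \<le> \<alpha> l \<longrightarrow> (\<exists>\<theta> E. 0 \<le> \<theta> \<and> \<theta> \<le> 1 \<and>
     \<beta> *\<^sub>R (x0 - x) = \<theta> *\<^sub>R Ts x (F x - g) + E \<and>
     norm (R x \<beta> E) \<le> norm (x - xd) / 8 + \<delta> / sqrt (\<alpha> l)))"

lemma residual_representable_start: "\<delta> \<ge> 0 \<Longrightarrow> residual_representable g \<delta> 0 x0"
  unfolding residual_representable_def
proof (intro allI impI exI[of _ 0] conjI)
  fix \<beta> assume "\<delta> \<ge> 0" "0 < \<beta> \<and> \<beta> \<le> \<alpha> 0"
  then show "norm (R x0 \<beta> 0) \<le> norm e0 / 8 + \<delta> / sqrt (\<alpha> 0)"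
    using pair.norm_R[of \<beta> "F' x0" 0] \<alpha>_pos[of 0] by (simp add: mult_le_0_iff)
qed auto

text \<open>
  Replacing \<open>T\<^sub>k\<^sup>*\<close> by the adjoint at the new iterate costs \<open>L\<parallel>x\<^sub>k\<^sub>+\<^sub>1 - x\<^sub>k\<parallel>\<close> times the linearised
  residual, which is of order \<open>\<alpha>\<^sub>k\<parallel>v\<parallel>\<close>, and replacing the linearised residual by the true one
  costs a Taylor remainder.  Both are small multiples of \<open>\<parallel>x\<^sub>k\<^sub>+\<^sub>1 - x\<^sub>k\<parallel>\<close>, hence of the new error up
  to \<open>\<delta>/\<surd>\<alpha>\<^sub>k\<^sub>+\<^sub>1\<close>.
\<close>

lemma residual_representable_step:
  assumes I: "admissible k x" and n: "norm (g - y) \<le> \<delta>" and I': "admissible (Suc k) (gn_step g k x)" and \<delta>: "\<delta> \<ge> 0"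
    and c: "noise_controlled \<delta> k x"
  shows "residual_representable g \<delta> (Suc k) (gn_step g k x)"
  unfolding residual_representable_def
proof (intro allI impI)
  fix \<beta> assume "0 < \<beta> \<and> \<beta> \<le> \<alpha> (Suc k)"
  then have \<beta>: "0 < \<beta>" "\<beta> \<le> \<alpha> (Suc k)" "\<beta> \<le> \<alpha> k" using \<alpha>_decr[of k] by auto
  define x' where "x' = gn_step g k x"
  define h where "h = lin_residual g k x"
  define d where "d = F x' - g - h"
  define \<theta> where "\<theta> = \<beta> / \<alpha> k"
  define E where "E = \<theta> *\<^sub>R (Ts x h - Ts x' h) - \<theta> *\<^sub>R Ts x' d"
  let ?\<Delta> = "norm (x' - x)" and ?a = "\<alpha> k"
  have a: "?a > 0" "\<alpha> (Suc k) > 0" by (rule \<alpha>_pos)+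
  have \<theta>: "0 \<le> \<theta>" "\<theta> \<le> 1" using \<beta> a by (auto simp: \<theta>_def)
  have "\<beta> *\<^sub>R (x0 - x') = \<theta> *\<^sub>R Ts x h"
  proof -
    have "\<beta> *\<^sub>R (x0 - x') = - \<theta> *\<^sub>R (?a *\<^sub>R (x' - x0))"
      using a by (simp add: \<theta>_def scaleR_diff_right)
    then show ?thesis unfolding x'_def step_optimality h_def by simp
  qed
  also have "\<dots> = \<theta> *\<^sub>R Ts x' (F x' - g) + E"
  proof -
    have "Ts x' d = Ts x' (F x' - g) - Ts x' h" unfolding d_def by (rule pair.S_diff)
    then show ?thesis by (simp add: E_def scaleR_diff_right)
  qed
  finally have eq: "\<beta> *\<^sub>R (x0 - x') = \<theta> *\<^sub>R Ts x' (F x' - g) + E" .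
  have Ld: "L * ?\<Delta> \<le> K * lam * sqrt ?a" unfolding x'_def by (rule L_step_length[OF I I'])
  have "norm (R x' \<beta> E) \<le> \<theta> * norm (R x' \<beta> (Ts x h - Ts x' h)) + \<theta> * norm (R x' \<beta> (Ts x' d))"
    using norm_triangle_ineq4[of "\<theta> *\<^sub>R R x' \<beta> (Ts x h - Ts x' h)" "\<theta> *\<^sub>R R x' \<beta> (Ts x' d)"] \<theta>
    by (simp only: E_def pair.R_diff[OF \<beta>(1)] pair.R_scaleR[OF \<beta>(1)] norm_scaleR abs_of_nonneg)
  moreover have "\<theta> * norm (R x' \<beta> (Ts x h - Ts x' h)) \<le> K * lam * ?\<Delta>"
  proof -
    have "?a * (\<theta> * norm (R x' \<beta> (Ts x h - Ts x' h))) = \<beta> * norm (R x' \<beta> (Ts x h - Ts x' h))"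
      using a by (simp add: \<theta>_def)
    also have "\<dots> \<le> L * ?\<Delta> * norm h"
      using pair.norm_R[OF \<beta>(1), of "F' x'" "Ts x h - Ts x' h"]
        Ts_lip[OF admissible_ball[OF I] admissible_ball[OF I'], of h] by (simp add: x'_def norm_minus_commute)
    also have "\<dots> \<le> L * ?\<Delta> * (K * ?a * norm v)"
      using lin_residual_le[OF I n c] L by (intro mult_left_mono) (auto simp: h_def)
    finally have "?a * (\<theta> * norm (R x' \<beta> (Ts x h - Ts x' h))) \<le> ?a * (K * lam * ?\<Delta>)"
      by (simp add: lam_def mult_ac)
    then show ?thesis using a by simp
  qed
  moreover have "\<theta> * norm (R x' \<beta> (Ts x' d)) \<le> K * lam / 2 * ?\<Delta>"
  proof -
    have "2 * sqrt \<beta> * norm (R x' \<beta> (Ts x' d)) \<le> L * ?\<Delta>\<^sup>2"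
      using pair.norm_R_S[OF \<beta>(1), of "F' x'" d] lin_residual_taylor[OF I I'] by (simp add: d_def h_def x'_def)
    from mult_mono[OF _ this, of "sqrt \<beta>" "sqrt ?a"]
    have "sqrt \<beta> * (2 * sqrt \<beta> * norm (R x' \<beta> (Ts x' d))) \<le> sqrt ?a * (L * ?\<Delta>\<^sup>2)"
      using \<beta> a by auto
    also have "\<dots> = sqrt ?a * ((L * ?\<Delta>) * ?\<Delta>)" by (simp add: power2_eq_square)
    also have "\<dots> \<le> sqrt ?a * ((K * lam * sqrt ?a) * ?\<Delta>)"
      using Ld a by (intro mult_left_mono mult_right_mono) auto
    also have "\<dots> = (sqrt ?a * sqrt ?a) * (K * lam * ?\<Delta>)" by (simp only: mult_ac)
    also have "\<dots> = ?a * (K * lam * ?\<Delta>)" using a by simp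
    also have "sqrt \<beta> * (2 * sqrt \<beta> * norm (R x' \<beta> (Ts x' d)))
        = 2 * ((sqrt \<beta> * sqrt \<beta>) * norm (R x' \<beta> (Ts x' d)))" by (simp only: mult_ac)
    finally have "?a * (\<theta> * norm (R x' \<beta> (Ts x' d))) \<le> ?a * (K * lam / 2 * ?\<Delta>)"
      using a \<beta> by (simp add: \<theta>_def)
    then show ?thesis using a by simp
  qed
  ultimately have "norm (R x' \<beta> E) \<le> 3/2 * (K * lam) * ?\<Delta>" by (simp add: algebra_simps)
  also have "\<dots> \<le> 3/2 * (K * lam) * (3 * K * norm (x' - xd) + K * (\<delta> / sqrt (\<alpha> (Suc k))))"
    using step_length_le_error[OF I n I' \<delta>] smallness by (intro mult_left_mono) (auto simp: x'_def)
  also have "\<dots> = (9/2 * (K * K * lam)) * norm (x' - xd) + (3/2 * (K * K * lam)) * (\<delta> / sqrt (\<alpha> (Suc k)))"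
    by (simp add: algebra_simps)
  also have "\<dots> \<le> (1/8) * norm (x' - xd) + 1 * (\<delta> / sqrt (\<alpha> (Suc k)))"
    using smallness \<delta> a by (intro add_mono mult_right_mono) auto
  finally have "norm (R x' \<beta> E) \<le> norm (x' - xd) / 8 + \<delta> / sqrt (\<alpha> (Suc k))" by simp
  with eq \<theta> show "\<exists>\<theta> E. 0 \<le> \<theta> \<and> \<theta> \<le> 1 \<and>
       \<beta> *\<^sub>R (x0 - gn_step g k x) = \<theta> *\<^sub>R Ts (gn_step g k x) (F (gn_step g k x) - g) + E \<and>
       norm (R (gn_step g k x) \<beta> E) \<le> norm (gn_step g k x - xd) / 8 + \<delta> / sqrt (\<alpha> (Suc k))"
    unfolding x'_def by blast
qed

text \<open>
  Add \<open>T\<^sub>x\<^sup>*T\<^sub>x e\<close> to the approximate optimality condition and invert \<open>\<beta> + T\<^sub>x\<^sup>*T\<^sub>x\<close>: the residual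
  appears with the factor \<open>1 - \<theta>\<close> and is controlled by the stopping rule.
\<close>

lemma stopped_vs_linear:
  assumes I: "admissible l x" and n: "norm (g - y) \<le> \<delta>" and \<delta>: "\<delta> \<ge> 0" and rep: "residual_representable g \<delta> l x"
    and st: "N x (\<alpha> l) (F x - g) \<le> \<tau> * \<delta>" and \<beta>: "0 < \<beta>" "\<beta> \<le> \<alpha> l"
  shows "norm (x - xd - \<beta> *\<^sub>R R x \<beta> e0)
    \<le> norm (x - xd) / 8 + (3/2 * (\<tau> + 1) * \<delta> + L * (norm (x - xd))\<^sup>2 / 2) / sqrt \<beta>"
proof -
  define e where "e = x - xd"
  define w where "w = F x - g"
  define p where "p = w - T x e"
  obtain \<theta> E where \<theta>: "0 \<le> \<theta>" "\<theta> \<le> 1" and eq: "\<beta> *\<^sub>R (x0 - x) = \<theta> *\<^sub>R Ts x w + E"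
    and E: "norm (R x \<beta> E) \<le> norm e / 8 + \<delta> / sqrt (\<alpha> l)"
    using rep \<beta> unfolding residual_representable_def w_def e_def by blast
  define z where "z = e0"
  have "\<beta> *\<^sub>R e + Ts x (T x e) = \<beta> *\<^sub>R z + (1 - \<theta>) *\<^sub>R Ts x w - E - Ts x p"
  proof -
    have "\<beta> *\<^sub>R e = \<beta> *\<^sub>R z - (\<theta> *\<^sub>R Ts x w + E)"
      unfolding eq[symmetric] by (simp add: e_def z_def algebra_simps)
    moreover have "Ts x (T x e) = Ts x w - Ts x p" unfolding p_def pair.S_diff by simp
    ultimately have "\<beta> *\<^sub>R e + Ts x (T x e) = \<beta> *\<^sub>R z - (\<theta> *\<^sub>R Ts x w + E) + (Ts x w - Ts x p)"
      by (simp only:)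
    then show ?thesis by (simp add: algebra_simps)
  qed
  then have "R x \<beta> (\<beta> *\<^sub>R z + (1 - \<theta>) *\<^sub>R Ts x w - E - Ts x p) = e"
    by (rule pair.R_eqI[OF \<beta>(1)])
  then have "e - \<beta> *\<^sub>R R x \<beta> e0 = (1 - \<theta>) *\<^sub>R R x \<beta> (Ts x w) - R x \<beta> E - R x \<beta> (Ts x p)"
    unfolding z_def[symmetric] by (auto simp: pair.R_diff pair.R_add pair.R_scaleR \<beta>)
  then have "norm (e - \<beta> *\<^sub>R R x \<beta> e0)
      \<le> (1 - \<theta>) * norm (R x \<beta> (Ts x w)) + norm (R x \<beta> E) + norm (R x \<beta> (Ts x p))"
    using norm_triangle_ineq4[of "(1 - \<theta>) *\<^sub>R R x \<beta> (Ts x w) - R x \<beta> E" "R x \<beta> (Ts x p)"]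
      norm_triangle_ineq4[of "(1 - \<theta>) *\<^sub>R R x \<beta> (Ts x w)" "R x \<beta> E"] \<theta> by simp
  moreover have "(1 - \<theta>) * norm (R x \<beta> (Ts x w)) \<le> 3/2 * \<tau> * \<delta> / sqrt \<beta>"
  proof -
    have "(1 - \<theta>) * norm (R x \<beta> (Ts x w)) \<le> 1 * norm (R x \<beta> (Ts x w))"
      using \<theta> by (intro mult_right_mono) auto
    also have "sqrt \<beta> * norm (R x \<beta> (Ts x w)) \<le> 3/2 * \<tau> * \<delta>"
      using pair.norm_R_S_le_res_norm[OF \<beta>, of "F' x" w] st by (simp add: w_def)
    then have "1 * norm (R x \<beta> (Ts x w)) \<le> 3/2 * \<tau> * \<delta> / sqrt \<beta>"
      using \<beta> by (simp add: field_simps)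
    finally show ?thesis .
  qed
  moreover have "norm (R x \<beta> (Ts x p)) \<le> (L * (norm e)\<^sup>2 / 2 + \<delta> / 2) / sqrt \<beta>"
    using pair.norm_R_S[OF \<beta>(1), of "F' x" p] norm_p_le[OF I n] \<beta>
    by (simp add: p_def w_def e_def field_simps)
  moreover have "\<delta> / sqrt (\<alpha> l) \<le> \<delta> / sqrt \<beta>"
    using \<beta> \<delta> by (intro divide_left_mono) auto
  ultimately show ?thesis using E
    by (simp add: e_def add_divide_distrib algebra_simps)
qed

text \<open>
  In \<open>(e, \<alpha>(\<alpha> + A\<^sub>x)\<^sup>-\<^sup>1 T\<^sub>x\<^sup>* v) = (\<alpha>(\<alpha> + T\<^sub>xT\<^sub>x\<^sup>*)\<^sup>-\<^sup>1 T\<^sub>x e, v)\<close> the first factor on the right is bounded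
  by the weighted norm of \<open>T\<^sub>x e\<close>, which is the residual up to noise and Taylor remainder.  The other
  contributions to \<open>\<parallel>e\<parallel>\<^sup>2\<close> are small multiples of \<open>\<parallel>e\<parallel>\<^sup>2\<close> or carry the factor
  \<open>\<delta> \<parallel>e\<parallel>/\<surd>\<alpha>\<close>, where \<open>\<parallel>e\<parallel>/\<surd>\<alpha> \<le> K\<parallel>v\<parallel>/2\<close>.
\<close>

lemma L_stopped_error_sq:
  assumes I: "admissible l x" and n: "norm (g - y) \<le> \<delta>" and \<delta>: "\<delta> \<ge> 0" and rep: "residual_representable g \<delta> l x"
    and st: "N x (\<alpha> l) (F x - g) \<le> \<tau> * \<delta>" and \<tau>: "\<tau> \<ge> 0"
  shows "L * (norm (x - xd))\<^sup>2 \<le> (\<tau> + 1) * \<delta>"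
proof -
  define e where "e = x - xd"
  define Q where "Q = (norm e)\<^sup>2"
  let ?a = "\<alpha> l"
  have a: "?a > 0" by (rule \<alpha>_pos)
  have split: "Q = e \<bullet> (?a *\<^sub>R R x ?a (Ts x v)) + e \<bullet> (?a *\<^sub>R R x ?a (Ts xd v - Ts x v)) + e \<bullet> (e - ?a *\<^sub>R R x ?a e0)"
    by (simp add: Q_def power2_norm_eq_inner source pair.R_diff a inner_diff_right scaleR_diff_right)
  have "e \<bullet> (?a *\<^sub>R R x ?a (Ts x v)) = (?a *\<^sub>R adjoint_pair.R (Ts x) (T x) ?a (T x e)) \<bullet> v"
    using pair.inner_R[OF a, of e "F' x" "Ts x v"] by (simp add: pair.T_R[OF a, symmetric] pair.adj)
  also have "\<dots> \<le> norm (?a *\<^sub>R adjoint_pair.R (Ts x) (T x) ?a (T x e)) * norm v" by (rule norm_cauchy_schwarz)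
  also have "\<dots> \<le> N x ?a (T x e) * norm v"
    using pair.res_norm_components(1)[OF a, of "F' x" "T x e"] a by (intro mult_right_mono) auto
  also have "N x ?a (T x e) \<le> (\<tau> + 1) * \<delta> + L * Q"
  proof -
    have "N x ?a (T x e) \<le> N x ?a (F x - g) + N x ?a (- (F x - g - T x e))"
      using pair.res_norm_triangle[OF a, of "F' x" "F x - g" "- (F x - g - T x e)"] by simp
    also have "N x ?a (- (F x - g - T x e)) \<le> norm (F x - g - T x e)"
      using pair.res_norm_le_norm[OF a, of "F' x" "- (F x - g - T x e)"] by (metis norm_minus_cancel)
    finally show ?thesis using st norm_p_le[OF I n] by (simp add: e_def Q_def algebra_simps)
  qed
  finally have 1: "e \<bullet> (?a *\<^sub>R R x ?a (Ts x v)) \<le> (\<tau> + 1) * \<delta> * norm v + lam * Q"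
    by (simp add: mult_right_mono lam_def algebra_simps)
  have "e \<bullet> (?a *\<^sub>R R x ?a (Ts xd v - Ts x v)) \<le> norm e * (?a * norm (R x ?a (Ts xd v - Ts x v)))"
    using norm_cauchy_schwarz[of e "?a *\<^sub>R R x ?a (Ts xd v - Ts x v)"] a by simp
  also have "\<dots> \<le> norm e * (L * norm e * norm v)"
    using pair.norm_R[OF a, of "F' x" "Ts xd v - Ts x v"] Ts_lip[OF xd_ball admissible_ball[OF I], of v]
    by (intro mult_left_mono) (auto simp: e_def norm_minus_commute)
  finally have 2: "e \<bullet> (?a *\<^sub>R R x ?a (Ts xd v - Ts x v)) \<le> lam * Q"
    by (simp add: Q_def lam_def power2_eq_square mult_ac)
  define B where "B = 3/2 * (\<tau> + 1) * \<delta> + L * Q / 2"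
  have B: "B \<ge> 0" using \<tau> \<delta> L by (simp add: B_def Q_def)
  have ea: "norm e / sqrt ?a \<le> K * norm v / 2"
  proof -
    have "norm e \<le> K * lin_norm l" using I by (simp add: admissible_def e_def)
    also have "\<dots> \<le> K * (sqrt ?a * norm v / 2)" using smallness(1) by (intro mult_left_mono lin_norm_le) auto
    finally show ?thesis using a by (simp add: field_simps)
  qed
  have "e \<bullet> (e - ?a *\<^sub>R R x ?a e0) \<le> norm e * norm (e - ?a *\<^sub>R R x ?a e0)" by (rule norm_cauchy_schwarz)
  also have "\<dots> \<le> norm e * (norm e / 8 + B / sqrt ?a)"
    using stopped_vs_linear[OF I n \<delta> rep st a order_refl] by (intro mult_left_mono) (auto simp: e_def B_def Q_def)
  also have "\<dots> = Q / 8 + norm e / sqrt ?a * B" by (simp add: Q_def power2_eq_square algebra_simps)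
  also have "\<dots> \<le> Q / 8 + K * norm v / 2 * B" using ea B by (intro add_left_mono mult_right_mono)
  also have "\<dots> = Q / 8 + K * lam / 4 * Q + 3/4 * K * norm v * ((\<tau> + 1) * \<delta>)"
    by (simp add: B_def lam_def algebra_simps)
  finally have 3: "e \<bullet> (e - ?a *\<^sub>R R x ?a e0) \<le> Q / 8 + K * lam / 4 * Q + 3/4 * K * norm v * ((\<tau> + 1) * \<delta>)" .
  have Q0: "0 \<le> Q" by (simp add: Q_def)
  have "(2 * lam + 1/8 + K * lam / 4) * Q \<le> 1/2 * Q" using smallness Q0 by (intro mult_right_mono) auto
  then have 4: "2 * (lam * Q) + Q / 8 + K * lam / 4 * Q \<le> Q / 2" by (simp add: algebra_simps)
  define G where "G = norm v * ((\<tau> + 1) * \<delta>)"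
  have "e \<bullet> (?a *\<^sub>R R x ?a (Ts x v)) \<le> G + lam * Q" using 1 by (simp add: G_def mult_ac)
  moreover have "e \<bullet> (e - ?a *\<^sub>R R x ?a e0) \<le> Q / 8 + K * lam / 4 * Q + 3/4 * (K * G)"
    using 3 by (simp add: G_def mult_ac)
  ultimately have "Q \<le> 2 * G + 3/2 * (K * G)" using split 2 4 by linarith
  then have "Q \<le> (2 + 3/2 * K) * G" by (simp add: distrib_right)
  from mult_left_mono[OF this L] have "L * Q \<le> ((2 + 3/2 * K) * lam) * ((\<tau> + 1) * \<delta>)"
    by (simp only: lam_def G_def mult_ac)
  also have "\<dots> \<le> 1 * ((\<tau> + 1) * \<delta>)"
    using smallness \<tau> \<delta> by (intro mult_right_mono) (auto simp: algebra_simps)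
  finally show ?thesis by (simp add: Q_def e_def)
qed

text \<open>
  Take \<open>\<beta> = \<alpha>\<^sub>k\<close> and replace the derivative at \<open>x\<close> by the one at the solution, which changes the
  regularised initial error by a small multiple of \<open>\<parallel>e\<parallel>\<close> for every parameter.
\<close>

lemma stopped_error_late:
  assumes I: "admissible l x" and n: "norm (g - y) \<le> \<delta>" and \<delta>: "\<delta> \<ge> 0" and rep: "residual_representable g \<delta> l x"
    and st: "N x (\<alpha> l) (F x - g) \<le> \<tau> * \<delta>" and \<tau>: "\<tau> \<ge> 0" and lk: "l \<le> k"
  shows "norm (x - xd) \<le> 2 * lin_norm k + 4 * (\<tau> + 1) * (\<delta> / sqrt (\<alpha> k))"
proof -
  define e where "e = x - xd"
  let ?a = "\<alpha> k"
  have a: "0 < ?a" "?a \<le> \<alpha> l" using \<alpha>_pos \<alpha>_mono[OF lk] by auto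
  have "norm (e - ?a *\<^sub>R R x ?a e0) \<le> norm e / 8 + (3/2 * (\<tau> + 1) * \<delta> + L * (norm e)\<^sup>2 / 2) / sqrt ?a"
    unfolding e_def by (rule stopped_vs_linear[OF I n \<delta> rep st a])
  also have "\<dots> \<le> norm e / 8 + (2 * (\<tau> + 1) * \<delta>) / sqrt ?a"
  proof (intro add_left_mono divide_right_mono)
    show "3/2 * (\<tau> + 1) * \<delta> + L * (norm e)\<^sup>2 / 2 \<le> 2 * (\<tau> + 1) * \<delta>"
      using L_stopped_error_sq[OF I n \<delta> rep st \<tau>] unfolding e_def mult.assoc by linarith
  qed (use a in simp)
  finally have 1: "norm (e - ?a *\<^sub>R R x ?a e0) \<le> norm e / 8 + 2 * ((\<tau> + 1) * (\<delta> / sqrt ?a))"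
    by (simp only: times_divide_eq_right mult.assoc)
  have "5/4 * lam * norm e \<le> 1/8 * norm e" using smallness by (intro mult_right_mono) auto
  then have 2: "norm (?a *\<^sub>R R x ?a e0 - lin_error k) \<le> norm e / 8"
    using lin_perturb[OF admissible_ball[OF I] a(1)] by (simp add: lin_error_def e_def)
  have "norm e \<le> norm (e - ?a *\<^sub>R R x ?a e0) + norm (?a *\<^sub>R R x ?a e0 - lin_error k) + lin_norm k"
    using norm_triangle_ineq[of "e - ?a *\<^sub>R R x ?a e0" "(?a *\<^sub>R R x ?a e0 - lin_error k) + lin_error k"]
      norm_triangle_ineq[of "?a *\<^sub>R R x ?a e0 - lin_error k" "lin_error k"] by (simp add: lin_norm_def)
  then have *: "3/4 * norm e \<le> lin_norm k + 2 * ((\<tau> + 1) * (\<delta> / sqrt ?a))" using 1 2 by linarith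
  define D where "D = (\<tau> + 1) * (\<delta> / sqrt ?a)"
  have "0 \<le> lin_norm k" "0 \<le> D" using \<delta> \<tau> a by (auto simp: D_def)
  with *[folded D_def] have "norm e \<le> 2 * lin_norm k + 4 * D" by linarith
  then have "norm e \<le> 2 * lin_norm k + 4 * ((\<tau> + 1) * (\<delta> / sqrt ?a))" by (simp only: D_def)
  then show ?thesis by (simp only: e_def mult.assoc)
qed

end

context irgn_noisy
begin

theorem stopped_error:
  assumes "stop l" "\<And>j. j < l \<Longrightarrow> \<not> stop j"
  shows "norm (iter l - xd) \<le> K * lin_norm l"
    and "norm (iter l - xd) \<le> K * lin_norm k + 4 * (\<tau> + 1) * (\<delta> / sqrt (\<alpha> k))"
proof -
  have I: "admissible l (iter l)" using before_stop[OF assms(2)] by blast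
  then show *: "norm (iter l - xd) \<le> K * lin_norm l" by (simp add: admissible_def)
  have nonneg_noise: "0 \<le> 4 * (\<tau> + 1) * (\<delta> / sqrt (\<alpha> k))" using \<tau> \<delta> \<alpha>_pos[of k] by simp
  show "norm (iter l - xd) \<le> K * lin_norm k + 4 * (\<tau> + 1) * (\<delta> / sqrt (\<alpha> k))"
  proof (cases "l \<le> k")
    case False
    then have "K * lin_norm l \<le> K * lin_norm k" using smallness(1) by (intro mult_left_mono lin_norm_antimono) auto
    with * nonneg_noise show ?thesis by linarith
  next
    case True
    have "residual_representable g \<delta> l (iter l)"
    proof (cases l)
      case 0
      then show ?thesis using residual_representable_start \<delta> by simp
    next
      case (Suc j)
      have "admissible j (iter j)" "noise_controlled \<delta> j (iter j)"
        using before_stop[of j] assms(2) Suc by auto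
      then show ?thesis
        using residual_representable_step[OF _ noise, of j "iter j"] I \<delta> irgn_Suc[of g j] Suc by simp
    qed
    then have "norm (iter l - xd) \<le> 2 * lin_norm k + 4 * (\<tau> + 1) * (\<delta> / sqrt (\<alpha> k))"
      using stopped_error_late[OF I noise _ _ _ _ True] assms(1) \<delta> \<tau> by (simp add: stop_iff)
    moreover have "2 * lin_norm k \<le> K * lin_norm k" using smallness(1) by (intro mult_right_mono) auto
    ultimately show ?thesis by linarith
  qed
qed

end

section \<open>Quasi-optimality and convergence rates\<close>

context irgn_problem
begin

lemma lin_norm_powr:
  assumes "0 < s" "s \<le> 1" and "e0 = op_powr (Ts xd \<circ> T xd) s \<omega>"
  shows "lin_norm k \<le> \<alpha> k powr s * norm \<omega>"
  unfolding lin_norm_def lin_error_def assms(3) by (rule pair.scaled_R_op_powr[OF \<alpha>_pos assms(1,2)])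

end

lemma balancing_index:
  fixes \<alpha> :: "nat \<Rightarrow> real"
  assumes \<alpha>: "\<And>k. \<alpha> k > 0" "\<And>k. \<alpha> k \<le> r * \<alpha> (Suc k)" "\<alpha> \<longlonglongrightarrow> 0" and c: "c > 0" "c < \<alpha> 0" and r: "r > 0"
  obtains k where "\<alpha> k \<le> c" "c \<le> r * \<alpha> k"
proof -
  define k where "k = (LEAST k. \<alpha> k \<le> c)"
  have "\<exists>k. \<alpha> k \<le> c"
    using order_tendstoD(2)[OF \<alpha>(3) c(1)] by (auto simp: eventually_sequentially intro: less_imp_le)
  then have k: "\<alpha> k \<le> c" "\<And>j. j < k \<Longrightarrow> \<not> \<alpha> j \<le> c"
    unfolding k_def by (rule LeastI_ex, blast dest: not_less_Least)
  then obtain j where j: "k = Suc j" using c(2) by (cases k) auto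
  have "c \<le> r * \<alpha> k" using k(2)[of j] \<alpha>(2)[of j] by (simp add: j)
  with k(1) show ?thesis by (rule that)
qed

context irgn_noisy
begin

text \<open>
  The two terms \<open>\<alpha>\<^bsup>\<nu>/2\<^esup>\<parallel>\<omega>\<parallel>\<close> and \<open>\<delta>/\<surd>\<alpha>\<close> agree at \<open>\<alpha> = b\<^sup>2\<close> with \<open>b\<^bsup>1+\<nu>\<^esup> = \<delta>/\<parallel>\<omega>\<parallel>\<close>,
  and some \<open>\<alpha>\<^sub>k\<close> lies within a factor \<open>r\<close> below \<open>b\<^sup>2\<close>, unless already \<open>\<alpha>\<^sub>0 \<le> b\<^sup>2\<close>.  In that case
  \<open>\<alpha>\<^sub>l \<le> b\<^sup>2\<close> for the stopping index \<open>l\<close> too, and \<open>\<parallel>e\<^sub>l\<parallel> \<le> K\<parallel>lin\<^sub>l\<parallel>\<close> suffices.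
\<close>

lemma stopped_rate:
  assumes l: "stop l" "\<And>j. j < l \<Longrightarrow> \<not> stop j" and \<alpha>0: "\<alpha> \<longlonglongrightarrow> 0" 
    and \<nu>: "1 \<le> \<nu>" "\<nu> \<le> 2"
    and src: "e0 = op_powr (Ts xd \<circ> T xd) (\<nu> / 2) \<omega>"
  shows "norm (iter l - xd) \<le> (K + 4 * (\<tau> + 1) * r) * norm \<omega> powr (1 / (1 + \<nu>)) * \<delta> powr (\<nu> / (1 + \<nu>))"
proof -
  have lin_norm: "lin_norm k \<le> \<alpha> k powr (\<nu> / 2) * norm \<omega>" for k
    by (rule lin_norm_powr[OF _ _ src]) (use \<nu> in auto)
  have K: "K \<ge> 0" using smallness(1) by simp
  show ?thesis
  proof (cases "\<omega> = 0")
    case True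
    then have "lin_norm l = 0" using lin_norm[of l] lin_norm_nonneg[of l] by simp
    then have "norm (iter l - xd) \<le> 0" using stopped_error(1)[OF l] by simp
    then show ?thesis using True by simp
  next
    case False
    define w where "w = norm \<omega>"
    have w: "w > 0" using False by (simp add: w_def)
    define b where "b = (\<delta> / w) powr (1 / (1 + \<nu>))"
    have b: "b > 0" using \<delta> w by (simp add: b_def)
    have bnu: "b powr (1 + \<nu>) = \<delta> / w" using \<nu> w \<delta> by (simp add: b_def powr_powr)
    define G where "G = w * b powr \<nu>"
    have G0: "G \<ge> 0" using w by (simp add: G_def)
    have G1: "\<delta> / b = G"
    proof -
      have "\<delta> = w * (b * b powr \<nu>)" using bnu w b by (simp add: powr_add field_simps)
      then show ?thesis using b by (simp add: G_def)
    qed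
    have G2: "G = w powr (1 / (1 + \<nu>)) * \<delta> powr (\<nu> / (1 + \<nu>))"
    proof -
      have b_nu: "b powr \<nu> = \<delta> powr (\<nu> / (1 + \<nu>)) / w powr (\<nu> / (1 + \<nu>))"
        using \<delta> w by (simp add: b_def powr_powr powr_divide)
      have "w = w powr (1 / (1 + \<nu>)) * w powr (\<nu> / (1 + \<nu>))"
        using w \<nu> by (simp add: powr_add[symmetric] add_divide_distrib[symmetric])
      moreover have "w powr (\<nu> / (1 + \<nu>)) > 0" using w by simp
      ultimately have "w * (\<delta> powr (\<nu> / (1 + \<nu>)) / w powr (\<nu> / (1 + \<nu>)))
          = w powr (1 / (1 + \<nu>)) * \<delta> powr (\<nu> / (1 + \<nu>))"
        by (simp add: field_simps)
      then show ?thesis by (simp only: G_def b_nu)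
    qed
    have pw: "\<alpha> k powr (\<nu> / 2) * w \<le> G" if "\<alpha> k \<le> b\<^sup>2" for k
    proof -
      have "\<alpha> k powr (\<nu> / 2) \<le> (b\<^sup>2) powr (\<nu> / 2)"
        using that \<alpha>_pos[of k] \<nu> by (intro powr_mono2) auto
      also have "\<dots> = b powr \<nu>" using b powr_powr[of b 2 "\<nu> / 2"] by simp
      finally show ?thesis using w by (simp add: G_def mult.commute)
    qed
    have "norm (iter l - xd) \<le> (K + 4 * (\<tau> + 1) * r) * G"
    proof (cases "\<alpha> 0 \<le> b\<^sup>2")
      case True
      then have "\<alpha> l \<le> b\<^sup>2" using \<alpha>_mono[of 0 l] by simp
      from pw[OF this] lin_norm[of l] have "lin_norm l \<le> G" by (simp add: w_def)
      then have "norm (iter l - xd) \<le> K * G" using stopped_error(1)[OF l] mult_left_mono[OF _ K] by fastforce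
      also have "\<dots> \<le> (K + 4 * (\<tau> + 1) * r) * G" using G0 \<tau> r by (intro mult_right_mono) auto
      finally show ?thesis .
    next
      case False
      obtain k where k: "\<alpha> k \<le> b\<^sup>2" "b\<^sup>2 \<le> r * \<alpha> k"
        using balancing_index[of \<alpha> r "b\<^sup>2"] \<alpha>_pos \<alpha>_ratio \<alpha>0 b False r by (auto simp: not_le)
      have "lin_norm k \<le> G" using pw[OF k(1)] lin_norm[of k] by (simp add: w_def)
      moreover have "\<delta> / sqrt (\<alpha> k) \<le> r * G"
      proof -
        have "b\<^sup>2 \<le> (r * sqrt (\<alpha> k))\<^sup>2"
        proof -
          have "r * \<alpha> k \<le> r * (r * \<alpha> k)" using r \<alpha>_pos[of k] by (intro mult_left_mono) auto
          then show ?thesis using k(2) \<alpha>_pos[of k] by (simp add: power_mult_distrib power2_eq_square mult_ac)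
        qed
        then have "b \<le> r * sqrt (\<alpha> k)" by (rule power2_le_imp_le) (use r \<alpha>_pos[of k] in auto)
        then have "\<delta> * b \<le> \<delta> * (r * sqrt (\<alpha> k))" using \<delta> by simp
        then have "\<delta> / sqrt (\<alpha> k) \<le> r * (\<delta> / b)" using b \<alpha>_pos[of k] by (simp add: field_simps)
        then show ?thesis by (simp add: G1)
      qed
      ultimately have "K * lin_norm k + 4 * (\<tau> + 1) * (\<delta> / sqrt (\<alpha> k)) \<le> K * G + 4 * (\<tau> + 1) * (r * G)"
        using K \<tau> by (intro add_mono mult_left_mono) auto
      then show ?thesis using stopped_error(2)[OF l, of k] by (simp add: algebra_simps)
    qed
    then show ?thesis by (simp add: G2 w_def mult.assoc)
  qed
qed

text \<open>
  The linearised error is exchanged for the noise-free one by \<open>noise_free_lower\<close>.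
\<close>

lemma stopped_quasi_optimal:
  assumes l: "stop l" "\<And>j. j < l \<Longrightarrow> \<not> stop j"
  shows "norm (iter l - xd) \<le> (2 * K + 4 * (\<tau> + 1)) * (INF k. norm (irgn F F' \<alpha> x0 y k - xd) + \<delta> / sqrt (\<alpha> k))"
proof -
  define C where "C = 2 * K + 4 * (\<tau> + 1)"
  have C: "C > 0" using smallness(1) \<tau> by (simp add: C_def)
  have "norm (iter l - xd) / C \<le> norm (irgn F F' \<alpha> x0 y k - xd) + \<delta> / sqrt (\<alpha> k)" for k
  proof -
    let ?n = "norm (irgn F F' \<alpha> x0 y k - xd)" and ?d = "\<delta> / sqrt (\<alpha> k)"
    have d: "?d \<ge> 0" using \<delta> \<alpha>_pos[of k] by simp
    have "norm (iter l - xd) \<le> K * lin_norm k + 4 * (\<tau> + 1) * ?d" by (rule stopped_error(2)[OF l])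
    also have "\<dots> \<le> K * (2 * ?n) + 4 * (\<tau> + 1) * ?d"
      using smallness(1) by (intro add_right_mono mult_left_mono noise_free_lower) auto
    also have "\<dots> \<le> C * ?n + C * ?d"
    proof (rule add_mono)
      have "(2 * K) * ?n \<le> C * ?n" using \<tau> by (intro mult_right_mono) (auto simp: C_def)
      then show "K * (2 * ?n) \<le> C * ?n" by simp
      show "4 * (\<tau> + 1) * ?d \<le> C * ?d"
        using d smallness(1) by (intro mult_right_mono) (auto simp: C_def)
    qed
    finally show ?thesis using C by (simp add: field_simps)
  qed
  then have "norm (iter l - xd) / C \<le> (INF k. norm (irgn F F' \<alpha> x0 y k - xd) + \<delta> / sqrt (\<alpha> k))"
    by (intro cINF_greatest) auto
  then show ?thesis using C unfolding C_def[symmetric] by (simp add: field_simps)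
qed

end

theorem theorem1p1:
  fixes r \<tau> :: real
  assumes "r > 1" and "\<tau> > 2"
  shows "\<exists>\<eta>>0. \<forall>(F :: 'a::{real_inner,banach} \<Rightarrow> 'b::{real_inner,banach}) (F' :: 'a \<Rightarrow> 'a \<Rightarrow>\<^sub>L 'b)
      (D :: 'a set) (xd :: 'a) (y :: 'b) (x0 :: 'a) (\<alpha> :: nat \<Rightarrow> real) (\<rho> :: real) (L :: real) (v :: 'b).
    (\<forall>x\<in>D. (F has_derivative blinfun_apply (F' x)) (at x within D)) \<longrightarrow>
    xd \<in> D \<longrightarrow> F xd = y \<longrightarrow>
    (\<forall>k. \<alpha> k > 0 \<and> 1 \<le> \<alpha> k / \<alpha> (Suc k) \<and> \<alpha> k / \<alpha> (Suc k) \<le> r) \<longrightarrow> \<alpha> \<longlonglongrightarrow> 0 \<longrightarrow>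
    ball xd \<rho> \<subseteq> D \<longrightarrow> \<rho> > 4 * norm (x0 - xd) \<longrightarrow>
    (\<forall>x\<in>ball xd \<rho>. \<forall>z\<in>ball xd \<rho>. norm (F' x - F' z) \<le> L * norm (x - z)) \<longrightarrow>
    (\<forall>x\<in>ball xd \<rho>. norm (F' x) \<le> sqrt (\<alpha> 0)) \<longrightarrow>
    x0 - xd = adjoint (blinfun_apply (F' xd)) v \<longrightarrow>
    v \<in> {w. adjoint (blinfun_apply (F' xd)) w = 0}\<^sup>\<bottom> \<longrightarrow>
    L * norm v \<le> \<eta> \<longrightarrow>
    (\<forall>k. irgn F F' \<alpha> x0 y k \<in> D) \<and>
    (\<exists>C>0. \<forall>\<delta>>0. \<forall>y\<delta>. norm (y\<delta> - y) \<le> \<delta> \<longrightarrow>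
      (let k\<delta> = stop_index F F' \<alpha> x0 y\<delta> \<tau> \<delta>; x\<delta> = irgn F F' \<alpha> x0 y\<delta> in
         (\<exists>k. stop_rule F F' \<alpha> x0 y\<delta> \<tau> \<delta> k) \<and> (\<forall>k\<le>k\<delta>. x\<delta> k \<in> D) \<and>
         norm (x\<delta> k\<delta> - xd) \<le> C * (INF k. norm (irgn F F' \<alpha> x0 y k - xd) + \<delta> / sqrt (\<alpha> k)) \<and>
         (\<forall>\<nu> \<omega>. 1 \<le> \<nu> \<longrightarrow> \<nu> \<le> 2 \<longrightarrow>
            x0 - xd = op_powr (adjoint (blinfun_apply (F' xd)) \<circ> blinfun_apply (F' xd)) (\<nu> / 2) \<omega> \<longrightarrow>
            norm (x\<delta> k\<delta> - xd) \<le> C * norm \<omega> powr (1 / (1 + \<nu>)) * \<delta> powr (\<nu> / (1 + \<nu>)))))"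
proof -
  define K where "K = 4 * r + 8 * r ^ 3"
  have K: "K > 0" using assms(1) by (simp add: K_def add_pos_pos)
  define \<eta> where "\<eta> = 1 / (100 * K\<^sup>2)"
  have \<eta>: "\<eta> > 0" using K by (simp add: \<eta>_def)
  define C where "C = 2 * K + 4 * (\<tau> + 1) * r"
  have C: "C > 0" using K assms by (simp add: C_def add_pos_pos)
  show ?thesis
  proof (rule exI[of _ \<eta>], rule conjI, rule \<eta>, intro allI impI, goal_cases)
    case (1 F F' D xd y x0 \<alpha> \<rho> L v)
    have decr: "\<alpha> (Suc k) \<le> \<alpha> k" and ratio: "\<alpha> k \<le> r * \<alpha> (Suc k)" for k
      using 1(4)[rule_format, of k] 1(4)[rule_format, of "Suc k"] by (auto simp: field_simps)
    have xd: "xd \<in> ball xd \<rho>" using 1(7) norm_ge_zero[of "x0 - xd"] by (simp del: norm_ge_zero)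
    \<comment> \<open>A negative \<open>L\<close> satisfies the Lipschitz condition when \<open>'a\<close> is trivial, hence the maximum.\<close>
    have small: "max L 0 * norm v \<le> \<eta>" using 1(12) \<eta> by (auto simp: max_def)
    interpret P: irgn_problem F F' xd x0 y v \<alpha> \<rho> "max L 0" r K
    proof
      show "(F has_derivative F' x) (at x within ball xd \<rho>)" if "x \<in> ball xd \<rho>" for x
        using 1(1,6) that by (blast intro: has_derivative_subset)
      show "norm (F' x - F' z) \<le> max L 0 * norm (x - z)" if "x \<in> ball xd \<rho>" "z \<in> ball xd \<rho>" for x z
        using 1(8) that mult_right_mono[of L "max L 0" "norm (x - z)"] by fastforce
      show "100 * K\<^sup>2 * (max L 0 * norm v) \<le> 1" using small K by (simp add: \<eta>_def field_simps)
    qed (use 1 xd decr ratio assms K_def in auto)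
    show ?case
    proof (rule conjI, rule allI)
      show "irgn F F' \<alpha> x0 y k \<in> D" for k
        using P.admissible_ball[OF P.noise_free_admissible] 1(6) by blast
      show "\<exists>C>0. \<forall>\<delta>>0. \<forall>y\<delta>. norm (y\<delta> - y) \<le> \<delta> \<longrightarrow>
      (let k\<delta> = stop_index F F' \<alpha> x0 y\<delta> \<tau> \<delta>; x\<delta> = irgn F F' \<alpha> x0 y\<delta> in
         (\<exists>k. stop_rule F F' \<alpha> x0 y\<delta> \<tau> \<delta> k) \<and> (\<forall>k\<le>k\<delta>. x\<delta> k \<in> D) \<and>
         norm (x\<delta> k\<delta> - xd) \<le> C * (INF k. norm (irgn F F' \<alpha> x0 y k - xd) + \<delta> / sqrt (\<alpha> k)) \<and>
         (\<forall>\<nu> \<omega>. 1 \<le> \<nu> \<longrightarrow> \<nu> \<le> 2 \<longrightarrow>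
            x0 - xd = op_powr (adjoint (blinfun_apply (F' xd)) \<circ> blinfun_apply (F' xd)) (\<nu> / 2) \<omega> \<longrightarrow>
            norm (x\<delta> k\<delta> - xd) \<le> C * norm \<omega> powr (1 / (1 + \<nu>)) * \<delta> powr (\<nu> / (1 + \<nu>))))"
      proof (rule exI[of _ C], rule conjI, rule C, intro allI impI, unfold Let_def)
        fix \<delta> :: real and y\<delta> :: 'b
        assume \<delta>: "\<delta> > 0" and noise: "norm (y\<delta> - y) \<le> \<delta>"
        interpret Q: irgn_noisy F F' xd x0 y v \<alpha> \<rho> "max L 0" r K y\<delta> \<tau> \<delta>
          by unfold_locales (use noise \<delta> assms in auto)
        define l where "l = stop_index F F' \<alpha> x0 y\<delta> \<tau> \<delta>"
        have ex: "\<exists>k. Q.stop k" by (rule Q.stops[OF 1(5)])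
        have l: "Q.stop l" "\<And>j. j < l \<Longrightarrow> \<not> Q.stop j"
          unfolding l_def stop_index_def using LeastI_ex[OF ex] not_less_Least by blast+
        have dom: "Q.iter k \<in> D" if "k \<le> l" for k
          using P.admissible_ball[of k "Q.iter k"] Q.before_stop[of k] l(2) that 1(6) by fastforce
        have inf0: "0 \<le> (INF k. norm (irgn F F' \<alpha> x0 y k - xd) + \<delta> / sqrt (\<alpha> k))"
          using \<delta> P.\<alpha>_pos by (intro cINF_greatest) (auto intro!: add_nonneg_nonneg simp: less_imp_le)
        have r1: "4 * \<tau> + 4 \<le> (4 * \<tau> + 4) * r" using assms by simp
        have "norm (Q.iter l - xd)
          \<le> (2 * K + 4 * (\<tau> + 1)) * (INF k. norm (irgn F F' \<alpha> x0 y k - xd) + \<delta> / sqrt (\<alpha> k))"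
          by (rule Q.stopped_quasi_optimal[OF l])
        also have "\<dots> \<le> C * (INF k. norm (irgn F F' \<alpha> x0 y k - xd) + \<delta> / sqrt (\<alpha> k))"
          using r1 inf0 by (intro mult_right_mono) (auto simp: C_def)
        finally have qo: "norm (Q.iter l - xd) \<le> C * (INF k. norm (irgn F F' \<alpha> x0 y k - xd) + \<delta> / sqrt (\<alpha> k))" .
        have rate: "norm (Q.iter l - xd) \<le> C * norm \<omega> powr (1 / (1 + \<nu>)) * \<delta> powr (\<nu> / (1 + \<nu>))"
          if "1 \<le> \<nu>" "\<nu> \<le> 2" and src: "x0 - xd = op_powr (P.Ts xd \<circ> P.T xd) (\<nu> / 2) \<omega>" for \<nu> \<omega>
        proof -
          have "norm (Q.iter l - xd)
            \<le> (K + 4 * (\<tau> + 1) * r) * norm \<omega> powr (1 / (1 + \<nu>)) * \<delta> powr (\<nu> / (1 + \<nu>))"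
            by (rule Q.stopped_rate[OF l 1(5) that])
          also have "\<dots> \<le> C * norm \<omega> powr (1 / (1 + \<nu>)) * \<delta> powr (\<nu> / (1 + \<nu>))"
            using K by (intro mult_right_mono) (auto simp: C_def)
          finally show ?thesis .
        qed
        from ex dom qo rate
        show "(\<exists>k. Q.stop k) \<and> (\<forall>k\<le>stop_index F F' \<alpha> x0 y\<delta> \<tau> \<delta>. Q.iter k \<in> D) \<and>
         norm (Q.iter (stop_index F F' \<alpha> x0 y\<delta> \<tau> \<delta>) - xd) \<le> C * (INF k. norm (irgn F F' \<alpha> x0 y k - xd) + \<delta> / sqrt (\<alpha> k)) \<and>
         (\<forall>\<nu> \<omega>. 1 \<le> \<nu> \<longrightarrow> \<nu> \<le> 2 \<longrightarrow>
            x0 - xd = op_powr (P.Ts xd \<circ> P.T xd) (\<nu> / 2) \<omega> \<longrightarrow>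
            norm (Q.iter (stop_index F F' \<alpha> x0 y\<delta> \<tau> \<delta>) - xd)
              \<le> C * norm \<omega> powr (1 / (1 + \<nu>)) * \<delta> powr (\<nu> / (1 + \<nu>)))"
          unfolding l_def by blast
      qed
    qed
  qed
qed

end
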